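(* A Superposed Term Rewrite System (STRS) $\mathfrak R$ is terminating if there exists a well-founded weakly monotonic quasi-ordering $\succeq$ on classical terms, where $\succ$ and $\succeq$ are closed under substitution, such that: - $l\succeq r_i$ for all rules $l\to\sum_{i=1}^n\alpha_i\cdot r_i\in\mathcal R$ (right-hand side written in canonical form, $\sum_{i=1}^n\alpha_i\cdot r_i\in\mathrm{CAN}$) and for all $i$; - $s\succ t$ for all dependency pairs $\langle s,t\rangle$ of $\mathfrak R$.
   Context: **Syntax.** $\mathcal X$ is a countable set of variables; $\mathcal A,\mathcal C,\mathcal F$ are pairwise disjoint signatures (symbols $b$ with arity $\mathrm{ar}(b)\in\mathbb N$) of amplitude, constructor and function symbols. Constructors include a unit $()$, $|0\rangle$, $|1\rangle$, $\mathtt 0$ (arity 0), $\mathtt S$ (arity 1), pairing $(\cdot,\cdot)$ (arity 2), $[\,]$ (arity 0) and list-cons $h::t$ (arity 2). Grammar: naturals $\iota::=x\mid\mathtt 0\mid\mathtt S(\iota)$; amplitudes $\alpha::=\mathtt a(\iota,\dots,\iota)\mid\alpha\cdot\alpha\mid\alpha+\alpha$; terms $t::=x\mid c(t,\dots,t)\mid f(t,\dots,t)\mid\alpha\cdot t\mid t+t$; values $v::=c(v,\dots,v)\mid\alpha\cdot v\ (\alpha\text{ ground})\mid v+v$. A term or amplitude is ground if it has no variable; $\mathscr T_0$ is the set of ground terms. A term is classical if it contains neither $+$ nor $\alpha\cdot$. A substitution $\sigma$ maps variables to values. **Amplitudes.** Each $\mathtt a\in\mathcal A$ has a total interpretation $[\![\mathtt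 a]\!]:\mathbb N^{\mathrm{ar}(\mathtt a)}\to\mathbb C$, extended to ground amplitudes in the obvious way (sums to sums, products to products, $\mathtt S^n(\mathtt 0)$ to $n$). For a non-ground $\alpha$, $[\![\alpha]\!]=\lambda$ means $[\![\alpha\sigma]\!]=\lambda$ for every $\sigma$ such that $\alpha\sigma$ is a ground amplitude. **Equivalence.** $\equiv$ is the smallest equivalence relation on terms, closed under all term contexts ($s\equiv t\Rightarrow C[s]\equiv C[t]$), with: $t_1+t_2\equiv t_2+t_1$; $t_1+(t_2+t_3)\equiv(t_1+t_2)+t_3$; $s+\alpha\cdot t\equiv s$ if $[\![\alpha]\!]=0$; $\alpha\cdot t\equiv t$ if $[\![\alpha]\!]=1$; $\alpha\cdot(\beta\cdot t)\equiv(\alpha\cdot\beta)\cdot t$; $\alpha\cdot(t_1+t_2)\equiv\alpha\cdot t_1+\alpha\cdot t_2$; $\alpha\cdot t+\beta\cdot t\equiv(\alpha+\beta)\cdot t$; and, for $b\in\mathcal C\uplus\mathcal F$, $b(\dots,\alpha\cdot t,\dots)\equiv\alpha\cdot b(\dots,t,\dots)$ and $b(\dots,t_1+t_2,\dots)\equiv b(\dots,t_1,\dots)+b(\dots,t_2,\dots)$. A canonical form of $t$ is a term $\sum_{i=1}^n\alpha_i\cdot t_i\equiv t$ with the $t_i$ pairwise distinct classical terms and $[\![\alpha_i]\!]\neq0$; $\mathrm{CAN}$ is the set of canonical forms. **STRS.** A rewrite rule is $l\to r$ with $l=f(p_1,\dots,p_n)$, $f\in\mathcal F$, each $p_i$ a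 classical term without function symbols, and $\mathrm{Var}(r)\subseteq\mathrm{Var}(l)$. An STRS $\mathfrak R$ consists of $\mathcal A,\mathcal C,\mathcal F,\mathcal X$, a set $\mathcal R$ of orthogonal rules (left-linear and with pairwise non-overlapping left-hand sides), and a main symbol $f\in\mathcal F$. **Reduction.** Evaluation contexts: $E::=\diamond\mid b(v_1,\dots,v_{i-1},E,t_{i+1},\dots,t_n)$ with $b\in\mathcal C\uplus\mathcal F$ and $v_j$ values. $\to_{\mathfrak R}\subseteq\mathscr T_0\times\mathscr T_0$ is defined inductively by: (C) if $l\to r\in\mathcal R$ and $E[l\sigma]$ is classical then $E[l\sigma]\to_{\mathfrak R}E[r\sigma]$; (E) if $s\equiv s'\to_{\mathfrak R}t'\equiv t$ then $s\to_{\mathfrak R}t$; (Q) if $\sum_i\alpha_i\cdot s_i\in\mathrm{CAN}$, $s_i\to^?_{\mathfrak R}t_i$ for all $i$, and $s_i\to_{\mathfrak R}t_i$ for some $i$, then $\sum_i\alpha_i\cdot s_i\to_{\mathfrak R}\sum_i\alpha_i\cdot t_i$. Here $s\to^?_{\mathfrak R}t$ iff ($s\in\mathrm{NF}_{\mathfrak R}$ and $t=s$) or $s\to_{\mathfrak R}t$, and $\mathrm{NF}_{\mathfrak R}$ is the set of ground terms with no $\to_{\mathfrak R}$-reduct. A term terminates if, for some $k\in\mathbb N$, all reduction chains from it reach a normal form in at most $k$ steps; an STRS is terminating if every ground term terminates. **Dependency pairs and orders.** For a classical term $p$ and a term $r$, $p\triangleleft_{\mathrm{CAN}}r$ means $r\equiv\sum_{i=1}^n\alpha_i\cdot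 r_i\in\mathrm{CAN}$ with $r_i=p$ for some $i$. Each $f\in\mathcal F$ is given a new tuple symbol $F$ of the same signature. If $f(s_1,\dots,s_n)\to r\in\mathcal R$ and $C[g(t_1,\dots,t_m)]\triangleleft_{\mathrm{CAN}}r$ for some context $C$ and $g\in\mathcal F$, then $\langle F(s_1,\dots,s_n),G(t_1,\dots,t_m)\rangle$ is a dependency pair of $\mathfrak R$. The quasi-order is on classical terms over the signature extended with tuple symbols. A quasi-order $\succeq$ is a reflexive transitive relation with strict part $s\succ t\iff s\succeq t\wedge\neg(t\succeq s)$; it is well-founded if there is no infinite chain $t_1\succ t_2\succ\cdots$; weakly monotonic if $s\succeq t$ implies $b(\dots,s,\dots)\succeq b(\dots,t,\dots)$ for every symbol $b$; a relation is closed under substitution if it is preserved by applying any substitution (mapping variables to classical values) to both sides. *)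

theory Defs
  imports Complex_Main "HOL-Library.Countable"
begin

section \<open>Syntax\<close>

text \<open>The fixed constructors are built in; further constructors are named by elements of \<open>'c\<close>.\<close>

datatype 'c con =
  UnitC | Ket0 | Ket1 | ZeroC | SuccC | PairC | NilC | ConsC | UserC 'c

text \<open>
  Raw syntax. Variables, amplitude symbols, constructors and function symbols have separate
  types, which makes the signatures disjoint. That symbols belong to the signature, that arities
  are respected and that the arguments of an amplitude symbol are naturals is
  the content of \<open>wf_trm\<close> and \<open>wf_amp\<close> below. The generated functions \<open>tvars\<close> and \<open>avars\<close> include
  the variables occurring inside amplitudes.
\<close>

datatype (tvars: 'x, 'a, 'c, 'f) trm =
    Var 'x
  | Con "'c con" "('x, 'a, 'c, 'f) trm list"
  | Fun 'f "('x, 'a, 'c, 'f) trm list"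
  | Scale "('x, 'a, 'c, 'f) amp" "('x, 'a, 'c, 'f) trm"
  | Add "('x, 'a, 'c, 'f) trm" "('x, 'a, 'c, 'f) trm"
and (avars: 'x, 'a, 'c, 'f) amp =
    Amp 'a "('x, 'a, 'c, 'f) trm list"
  | AMul "('x, 'a, 'c, 'f) amp" "('x, 'a, 'c, 'f) amp"
  | AAdd "('x, 'a, 'c, 'f) amp" "('x, 'a, 'c, 'f) amp"

text \<open>
  A symbol belongs to the signature iff its arity is defined. Only the values of \<open>amp_int b\<close> on lists
  of length \<open>amp_ar b\<close> are ever used.
\<close>

record ('a, 'c, 'f) signature =
  amp_ar :: "'a \<rightharpoonup> nat"
  amp_int :: "'a \<Rightarrow> nat list \<Rightarrow> complex"
  user_ar :: "'c \<rightharpoonup> nat"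
  fun_ar :: "'f \<rightharpoonup> nat"

fun con_ar :: "('a, 'c, 'f) signature \<Rightarrow> 'c con \<Rightarrow> nat option" where
  "con_ar \<Sigma> UnitC = Some 0"
| "con_ar \<Sigma> Ket0 = Some 0"
| "con_ar \<Sigma> Ket1 = Some 0"
| "con_ar \<Sigma> ZeroC = Some 0"
| "con_ar \<Sigma> SuccC = Some 1"
| "con_ar \<Sigma> PairC = Some 2"
| "con_ar \<Sigma> NilC = Some 0"
| "con_ar \<Sigma> ConsC = Some 2"
| "con_ar \<Sigma> (UserC c) = user_ar \<Sigma> c"

fun is_natural :: "('x, 'a, 'c, 'f) trm \<Rightarrow> bool" where
  "is_natural (Var x) = True"
| "is_natural (Con ZeroC []) = True"
| "is_natural (Con SuccC [t]) = is_natural t"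
| "is_natural _ = False"

fun wf_amp :: "('a, 'c, 'f) signature \<Rightarrow> ('x, 'a, 'c, 'f) amp \<Rightarrow> bool" where
  "wf_amp \<Sigma> (Amp b ts) = (amp_ar \<Sigma> b = Some (length ts) \<and> (\<forall>t\<in>set ts. is_natural t))"
| "wf_amp \<Sigma> (AMul \<alpha> \<beta>) = (wf_amp \<Sigma> \<alpha> \<and> wf_amp \<Sigma> \<beta>)"
| "wf_amp \<Sigma> (AAdd \<alpha> \<beta>) = (wf_amp \<Sigma> \<alpha> \<and> wf_amp \<Sigma> \<beta>)"

fun wf_trm :: "('a, 'c, 'f) signature \<Rightarrow> ('x, 'a, 'c, 'f) trm \<Rightarrow> bool" where
  "wf_trm \<Sigma> (Var x) = True"
| "wf_trm \<Sigma> (Con c ts) = (con_ar \<Sigma> c = Some (length ts) \<and> (\<forall>t\<in>set ts. wf_trm \<Sigma> t))"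
| "wf_trm \<Sigma> (Fun f ts) = (fun_ar \<Sigma> f = Some (length ts) \<and> (\<forall>t\<in>set ts. wf_trm \<Sigma> t))"
| "wf_trm \<Sigma> (Scale \<alpha> t) = (wf_amp \<Sigma> \<alpha> \<and> wf_trm \<Sigma> t)"
| "wf_trm \<Sigma> (Add s t) = (wf_trm \<Sigma> s \<and> wf_trm \<Sigma> t)"

definition ground_trms :: "('a, 'c, 'f) signature \<Rightarrow> ('x, 'a, 'c, 'f) trm set" where
  "ground_trms \<Sigma> = {t. wf_trm \<Sigma> t \<and> tvars t = {}}"

fun classical :: "('x, 'a, 'c, 'f) trm \<Rightarrow> bool" where
  "classical (Var x) = True"
| "classical (Con c ts) = (\<forall>t\<in>set ts. classical t)"
| "classical (Fun f ts) = (\<forall>t\<in>set ts. classical t)"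
| "classical (Scale \<alpha> t) = False"
| "classical (Add s t) = False"

text \<open>Classical terms without function symbols.\<close>

fun pattern :: "('x, 'a, 'c, 'f) trm \<Rightarrow> bool" where
  "pattern (Var x) = True"
| "pattern (Con c ts) = (\<forall>t\<in>set ts. pattern t)"
| "pattern _ = False"

fun value_shape :: "('x, 'a, 'c, 'f) trm \<Rightarrow> bool" where
  "value_shape (Var x) = False"
| "value_shape (Con c ts) = (\<forall>t\<in>set ts. value_shape t)"
| "value_shape (Fun f ts) = False"
| "value_shape (Scale \<alpha> t) = (avars \<alpha> = {} \<and> value_shape t)"
| "value_shape (Add s t) = (value_shape s \<and> value_shape t)"

definition vals :: "('a, 'c, 'f) signature \<Rightarrow> ('x, 'a, 'c, 'f) trm set" where
  "vals \<Sigma> = {v. wf_trm \<Sigma> v \<and> value_shape v}"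

text \<open>
  Substitution on raw syntax. If a variable inside an amplitude is replaced by something that is
  not a natural, the result is not well-formed.
\<close>

primrec subst :: "('x \<Rightarrow> ('x, 'a, 'c, 'f) trm) \<Rightarrow> ('x, 'a, 'c, 'f) trm \<Rightarrow> ('x, 'a, 'c, 'f) trm"
  and asubst :: "('x \<Rightarrow> ('x, 'a, 'c, 'f) trm) \<Rightarrow> ('x, 'a, 'c, 'f) amp \<Rightarrow> ('x, 'a, 'c, 'f) amp"
where
  "subst \<sigma> (Var x) = \<sigma> x"
| "subst \<sigma> (Con c ts) = Con c (map (subst \<sigma>) ts)"
| "subst \<sigma> (Fun f ts) = Fun f (map (subst \<sigma>) ts)"
| "subst \<sigma> (Scale \<alpha> t) = Scale (asubst \<sigma> \<alpha>) (subst \<sigma> t)"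
| "subst \<sigma> (Add s t) = Add (subst \<sigma> s) (subst \<sigma> t)"
| "asubst \<sigma> (Amp b ts) = Amp b (map (subst \<sigma>) ts)"
| "asubst \<sigma> (AMul \<alpha> \<beta>) = AMul (asubst \<sigma> \<alpha>) (asubst \<sigma> \<beta>)"
| "asubst \<sigma> (AAdd \<alpha> \<beta>) = AAdd (asubst \<sigma> \<alpha>) (asubst \<sigma> \<beta>)"

definition is_subst :: "('a, 'c, 'f) signature \<Rightarrow> ('x \<Rightarrow> ('x, 'a, 'c, 'f) trm) \<Rightarrow> bool" where
  "is_subst \<Sigma> \<sigma> = (\<forall>x. \<sigma> x \<in> vals \<Sigma>)"

datatype ('x, 'a, 'c, 'f) ctxt =
    Hole
  | ConCtxt "'c con" "('x, 'a, 'c, 'f) trm list" "('x, 'a, 'c, 'f) ctxt" "('x, 'a, 'c, 'f) trm list"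
  | FunCtxt 'f "('x, 'a, 'c, 'f) trm list" "('x, 'a, 'c, 'f) ctxt" "('x, 'a, 'c, 'f) trm list"
  | ScaleCtxt "('x, 'a, 'c, 'f) amp" "('x, 'a, 'c, 'f) ctxt"
  | AddCtxtL "('x, 'a, 'c, 'f) ctxt" "('x, 'a, 'c, 'f) trm"
  | AddCtxtR "('x, 'a, 'c, 'f) trm" "('x, 'a, 'c, 'f) ctxt"

fun fill :: "('x, 'a, 'c, 'f) ctxt \<Rightarrow> ('x, 'a, 'c, 'f) trm \<Rightarrow> ('x, 'a, 'c, 'f) trm" where
  "fill Hole t = t"
| "fill (ConCtxt c us C vs) t = Con c (us @ fill C t # vs)"
| "fill (FunCtxt f us C vs) t = Fun f (us @ fill C t # vs)"
| "fill (ScaleCtxt \<alpha> C) t = Scale \<alpha> (fill C t)"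
| "fill (AddCtxtL C u) t = Add (fill C t) u"
| "fill (AddCtxtR u C) t = Add u (fill C t)"

fun eval_ctxt :: "('a, 'c, 'f) signature \<Rightarrow> ('x, 'a, 'c, 'f) ctxt \<Rightarrow> bool" where
  "eval_ctxt \<Sigma> Hole = True"
| "eval_ctxt \<Sigma> (ConCtxt c us C vs) = (set us \<subseteq> vals \<Sigma> \<and> eval_ctxt \<Sigma> C)"
| "eval_ctxt \<Sigma> (FunCtxt f us C vs) = (set us \<subseteq> vals \<Sigma> \<and> eval_ctxt \<Sigma> C)"
| "eval_ctxt \<Sigma> _ = False"

section \<open>Interpretation of amplitudes\<close>

text \<open>Only meaningful on ground naturals and ground well-formed amplitudes.\<close>

fun nat_val :: "('x, 'a, 'c, 'f) trm \<Rightarrow> nat" where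
  "nat_val (Con SuccC [t]) = Suc (nat_val t)"
| "nat_val _ = 0"

fun amp_eval :: "('a, 'c, 'f) signature \<Rightarrow> ('x, 'a, 'c, 'f) amp \<Rightarrow> complex" where
  "amp_eval \<Sigma> (Amp b ts) = amp_int \<Sigma> b (map nat_val ts)"
| "amp_eval \<Sigma> (AMul \<alpha> \<beta>) = amp_eval \<Sigma> \<alpha> * amp_eval \<Sigma> \<beta>"
| "amp_eval \<Sigma> (AAdd \<alpha> \<beta>) = amp_eval \<Sigma> \<alpha> + amp_eval \<Sigma> \<beta>"

definition amp_is :: "('a, 'c, 'f) signature \<Rightarrow> ('x, 'a, 'c, 'f) amp \<Rightarrow> complex \<Rightarrow> bool" where
  "amp_is \<Sigma> \<alpha> z = (\<forall>\<sigma>. is_subst \<Sigma> \<sigma> \<and> wf_amp \<Sigma> (asubst \<sigma> \<alpha>) \<and> avars (asubst \<sigma> \<alpha>) = {}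
     \<longrightarrow> amp_eval \<Sigma> (asubst \<sigma> \<alpha>) = z)"

section \<open>Equivalence and canonical forms\<close>

inductive eq_axiom :: "('a, 'c, 'f) signature \<Rightarrow> ('x, 'a, 'c, 'f) trm \<Rightarrow> ('x, 'a, 'c, 'f) trm \<Rightarrow> bool"
  for \<Sigma> where
  add_comm: "eq_axiom \<Sigma> (Add s t) (Add t s)"
| add_assoc: "eq_axiom \<Sigma> (Add s (Add t u)) (Add (Add s t) u)"
| zero: "amp_is \<Sigma> \<alpha> 0 \<Longrightarrow> eq_axiom \<Sigma> (Add s (Scale \<alpha> t)) s"
| one: "amp_is \<Sigma> \<alpha> 1 \<Longrightarrow> eq_axiom \<Sigma> (Scale \<alpha> t) t"
| scale_scale: "eq_axiom \<Sigma> (Scale \<alpha> (Scale \<beta> t)) (Scale (AMul \<alpha> \<beta>) t)"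
| scale_add: "eq_axiom \<Sigma> (Scale \<alpha> (Add s t)) (Add (Scale \<alpha> s) (Scale \<alpha> t))"
| add_scale: "eq_axiom \<Sigma> (Add (Scale \<alpha> t) (Scale \<beta> t)) (Scale (AAdd \<alpha> \<beta>) t)"
| con_scale: "eq_axiom \<Sigma> (Con c (us @ Scale \<alpha> t # vs)) (Scale \<alpha> (Con c (us @ t # vs)))"
| con_add: "eq_axiom \<Sigma> (Con c (us @ Add s t # vs)) (Add (Con c (us @ s # vs)) (Con c (us @ t # vs)))"
| fun_scale: "eq_axiom \<Sigma> (Fun f (us @ Scale \<alpha> t # vs)) (Scale \<alpha> (Fun f (us @ t # vs)))"
| fun_add: "eq_axiom \<Sigma> (Fun f (us @ Add s t # vs)) (Add (Fun f (us @ s # vs)) (Fun f (us @ t # vs)))"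

inductive equiv_trm :: "('a, 'c, 'f) signature \<Rightarrow> ('x, 'a, 'c, 'f) trm \<Rightarrow> ('x, 'a, 'c, 'f) trm \<Rightarrow> bool"
  for \<Sigma> where
  ax: "eq_axiom \<Sigma> s t \<Longrightarrow> wf_trm \<Sigma> s \<Longrightarrow> wf_trm \<Sigma> t \<Longrightarrow> equiv_trm \<Sigma> s t"
| refl: "wf_trm \<Sigma> t \<Longrightarrow> equiv_trm \<Sigma> t t"
| sym: "equiv_trm \<Sigma> s t \<Longrightarrow> equiv_trm \<Sigma> t s"
| trans: "equiv_trm \<Sigma> s t \<Longrightarrow> equiv_trm \<Sigma> t u \<Longrightarrow> equiv_trm \<Sigma> s u"
| ctxt: "equiv_trm \<Sigma> s t \<Longrightarrow> wf_trm \<Sigma> (fill C s) \<Longrightarrow> wf_trm \<Sigma> (fill C t)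
    \<Longrightarrow> equiv_trm \<Sigma> (fill C s) (fill C t)"

text \<open>
  The term \<open>\<alpha>\<^sub>1\<cdot>t\<^sub>1 + (\<alpha>\<^sub>2\<cdot>t\<^sub>2 + \<dots>)\<close>. Sums are nonempty, since there is no null term;
  the bracketing is immaterial up to \<open>equiv_trm\<close>.
\<close>

fun superpos :: "('x, 'a, 'c, 'f) amp list \<Rightarrow> ('x, 'a, 'c, 'f) trm list \<Rightarrow> ('x, 'a, 'c, 'f) trm" where
  "superpos [\<alpha>] [t] = Scale \<alpha> t"
| "superpos (\<alpha> # \<alpha>s) (t # ts) = Add (Scale \<alpha> t) (superpos \<alpha>s ts)"
| "superpos _ _ = undefined"

text \<open>
  For a non-ground amplitude, a nonzero interpretation means that it is not the case that the
  interpretation is constantly zero.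
\<close>

definition canonical ::
  "('a, 'c, 'f) signature \<Rightarrow> ('x, 'a, 'c, 'f) amp list \<Rightarrow> ('x, 'a, 'c, 'f) trm list \<Rightarrow> bool" where
  "canonical \<Sigma> \<alpha>s ts = (length \<alpha>s = length ts \<and> ts \<noteq> [] \<and> distinct ts
     \<and> (\<forall>t\<in>set ts. wf_trm \<Sigma> t \<and> classical t) \<and> (\<forall>\<alpha>\<in>set \<alpha>s. wf_amp \<Sigma> \<alpha> \<and> \<not> amp_is \<Sigma> \<alpha> 0))"

definition canonical_form ::
  "('a, 'c, 'f) signature \<Rightarrow> ('x, 'a, 'c, 'f) amp list \<Rightarrow> ('x, 'a, 'c, 'f) trm list
   \<Rightarrow> ('x, 'a, 'c, 'f) trm \<Rightarrow> bool" where
  "canonical_form \<Sigma> \<alpha>s ts t = (canonical \<Sigma> \<alpha>s ts \<and> equiv_trm \<Sigma> (superpos \<alpha>s ts) t)"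

text \<open>
  Terms equivalent to a zero multiple of some term; they have no canonical form and
  play the role of the empty sum.
\<close>

definition null_trm :: "('a, 'c, 'f) signature \<Rightarrow> ('x, 'a, 'c, 'f) trm \<Rightarrow> bool" where
  "null_trm \<Sigma> t = (\<exists>\<alpha> u. amp_is \<Sigma> \<alpha> 0 \<and> equiv_trm \<Sigma> t (Scale \<alpha> u))"

definition in_can ::
  "('a, 'c, 'f) signature \<Rightarrow> ('x, 'a, 'c, 'f) trm \<Rightarrow> ('x, 'a, 'c, 'f) trm \<Rightarrow> bool" where
  "in_can \<Sigma> p r = (\<exists>\<alpha>s rs. canonical_form \<Sigma> \<alpha>s rs r \<and> p \<in> set rs)"

section \<open>Superposed term rewrite systems\<close>

record ('x, 'a, 'c, 'f) strs =
  sig :: "('a, 'c, 'f) signature"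
  rules :: "(('x, 'a, 'c, 'f) trm \<times> ('x, 'a, 'c, 'f) trm) set"
  main :: 'f

definition rewrite_rule ::
  "('a, 'c, 'f) signature \<Rightarrow> ('x, 'a, 'c, 'f) trm \<Rightarrow> ('x, 'a, 'c, 'f) trm \<Rightarrow> bool" where
  "rewrite_rule \<Sigma> l r = (wf_trm \<Sigma> l \<and> wf_trm \<Sigma> r \<and> tvars r \<subseteq> tvars l
     \<and> (\<exists>f ps. l = Fun f ps \<and> (\<forall>p\<in>set ps. pattern p)))"

text \<open>Variable occurrences of a classical term, with repetitions.\<close>

fun var_occs :: "('x, 'a, 'c, 'f) trm \<Rightarrow> 'x list" where
  "var_occs (Var x) = [x]"
| "var_occs (Con c ts) = concat (map var_occs ts)"
| "var_occs (Fun f ts) = concat (map var_occs ts)"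
| "var_occs _ = []"

definition left_linear ::
  "(('x, 'a, 'c, 'f) trm \<times> ('x, 'a, 'c, 'f) trm) \<Rightarrow> bool" where
  "left_linear \<rho> = distinct (var_occs (fst \<rho>))"

text \<open>
  A non-variable subterm of one left-hand side unifies with the other one. Two independent
  substitutions amount to unification after renaming the rules apart; these substitutions are
  arbitrary, as usual in unification, and need not map to values. The trivial overlap of
  a rule with itself at the root is excluded.
\<close>

definition overlap ::
  "(('x, 'a, 'c, 'f) trm \<times> ('x, 'a, 'c, 'f) trm) \<Rightarrow> (('x, 'a, 'c, 'f) trm \<times> ('x, 'a, 'c, 'f) trm) \<Rightarrow> bool"
where
  "overlap \<rho> \<rho>' = (\<exists>C u \<sigma> \<tau>. fst \<rho> = fill C u \<and> (\<forall>x. u \<noteq> Var x)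
     \<and> subst \<sigma> u = subst \<tau> (fst \<rho>') \<and> \<not> (\<rho> = \<rho>' \<and> C = Hole))"

definition orthogonal ::
  "(('x, 'a, 'c, 'f) trm \<times> ('x, 'a, 'c, 'f) trm) set \<Rightarrow> bool" where
  "orthogonal \<R> = ((\<forall>\<rho>\<in>\<R>. left_linear \<rho>) \<and> (\<forall>\<rho>\<in>\<R>. \<forall>\<rho>'\<in>\<R>. \<not> overlap \<rho> \<rho>'))"

definition is_strs :: "('x, 'a, 'c, 'f) strs \<Rightarrow> bool" where
  "is_strs S = ((\<forall>(l, r)\<in>rules S. rewrite_rule (sig S) l r) \<and> orthogonal (rules S)
     \<and> main S \<in> dom (fun_ar (sig S)))"

section \<open>Reduction\<close>

inductive classical_step ::
  "('x, 'a, 'c, 'f) strs \<Rightarrow> ('x, 'a, 'c, 'f) trm \<Rightarrow> ('x, 'a, 'c, 'f) trm \<Rightarrow> bool" for S where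
  "(l, r) \<in> rules S \<Longrightarrow> is_subst (sig S) \<sigma> \<Longrightarrow> eval_ctxt (sig S) E
   \<Longrightarrow> classical (fill E (subst \<sigma> l))
   \<Longrightarrow> fill E (subst \<sigma> l) \<in> ground_trms (sig S) \<Longrightarrow> fill E (subst \<sigma> r) \<in> ground_trms (sig S)
   \<Longrightarrow> classical_step S (fill E (subst \<sigma> l)) (fill E (subst \<sigma> r))"

text \<open>
  Rule \<open>Q\<close> refers to normal forms of the relation being defined, which is a negative occurrence.
  The relation is therefore first generated relative to a set \<open>N\<close> of terms that are allowed to
  stay put in rule \<open>Q\<close>. This set is only consulted on classical terms, where it is taken to consist
  of the terms without a \<open>classical_step\<close>. The theorems \<open>step_unfold\<close> and \<open>step_unique\<close> below
  justify this choice: \<open>step S\<close> is the one and only relation that is generated by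
  the three rules with \<open>N\<close> being its own set of normal forms.
\<close>

inductive step_rel ::
  "('x, 'a, 'c, 'f) strs \<Rightarrow> ('x, 'a, 'c, 'f) trm set \<Rightarrow> ('x, 'a, 'c, 'f) trm \<Rightarrow> ('x, 'a, 'c, 'f) trm \<Rightarrow> bool"
  for S N where
  C: "classical_step S s t \<Longrightarrow> step_rel S N s t"
| E: "equiv_trm (sig S) s s' \<Longrightarrow> step_rel S N s' t' \<Longrightarrow> equiv_trm (sig S) t' t
    \<Longrightarrow> s \<in> ground_trms (sig S) \<Longrightarrow> t \<in> ground_trms (sig S) \<Longrightarrow> step_rel S N s t"
| Q: "canonical (sig S) \<alpha>s ss \<Longrightarrow> length ts = length ss
    \<Longrightarrow> superpos \<alpha>s ss \<in> ground_trms (sig S) \<Longrightarrow> superpos \<alpha>s ts \<in> ground_trms (sig S)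
    \<Longrightarrow> (\<And>i. i < length ss \<Longrightarrow> (ss ! i \<in> N \<and> ts ! i = ss ! i) \<or> step_rel S N (ss ! i) (ts ! i))
    \<Longrightarrow> j < length ss \<Longrightarrow> step_rel S N (ss ! j) (ts ! j)
    \<Longrightarrow> step_rel S N (superpos \<alpha>s ss) (superpos \<alpha>s ts)"

definition step ::
  "('x, 'a, 'c, 'f) strs \<Rightarrow> ('x, 'a, 'c, 'f) trm \<Rightarrow> ('x, 'a, 'c, 'f) trm \<Rightarrow> bool" where
  "step S = step_rel S {s \<in> ground_trms (sig S). \<nexists>t. classical_step S s t}"

definition normal_forms ::
  "('x, 'a, 'c, 'f) strs \<Rightarrow> (('x, 'a, 'c, 'f) trm \<Rightarrow> ('x, 'a, 'c, 'f) trm \<Rightarrow> bool)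
   \<Rightarrow> ('x, 'a, 'c, 'f) trm set" where
  "normal_forms S R = {s \<in> ground_trms (sig S). \<nexists>t. R s t}"

text \<open>Every reduction chain starting in \<open>t\<close> has at most \<open>k\<close> steps, for some \<open>k\<close>.\<close>

definition terminates :: "('x, 'a, 'c, 'f) strs \<Rightarrow> ('x, 'a, 'c, 'f) trm \<Rightarrow> bool" where
  "terminates S t = (\<exists>k. \<forall>n u. (step S ^^ n) t u \<longrightarrow> n \<le> k)"

definition terminating :: "('x, 'a, 'c, 'f) strs \<Rightarrow> bool" where
  "terminating S = (\<forall>t\<in>ground_trms (sig S). terminates S t)"

section \<open>Dependency pairs and quasi-orders\<close>

datatype 'f tupled = Base 'f | Tup 'f

definition tupled_sig :: "('a, 'c, 'f) signature \<Rightarrow> ('a, 'c, 'f tupled) signature" where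
  "tupled_sig \<Sigma> = \<lparr>amp_ar = amp_ar \<Sigma>, amp_int = amp_int \<Sigma>, user_ar = user_ar \<Sigma>,
     fun_ar = (\<lambda>g. case g of Base f \<Rightarrow> fun_ar \<Sigma> f | Tup f \<Rightarrow> fun_ar \<Sigma> f)\<rparr>"

abbreviation base :: "('x, 'a, 'c, 'f) trm \<Rightarrow> ('x, 'a, 'c, 'f tupled) trm" where
  "base \<equiv> map_trm id id id Base"

inductive_set dependency_pairs ::
  "('x, 'a, 'c, 'f) strs \<Rightarrow> (('x, 'a, 'c, 'f tupled) trm \<times> ('x, 'a, 'c, 'f tupled) trm) set" for S where
  "(Fun f ss, r) \<in> rules S \<Longrightarrow> in_can (sig S) (fill C (Fun g ts)) r
   \<Longrightarrow> (Fun (Tup f) (map base ss), Fun (Tup g) (map base ts)) \<in> dependency_pairs S"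

text \<open>The classical, not necessarily ground, terms over the signature with tuple symbols.\<close>

definition tupled_trms :: "('a, 'c, 'f) signature \<Rightarrow> ('x, 'a, 'c, 'f tupled) trm set" where
  "tupled_trms \<Sigma> = {t. wf_trm (tupled_sig \<Sigma>) t \<and> classical t}"

definition strict :: "('t \<Rightarrow> 't \<Rightarrow> bool) \<Rightarrow> 't \<Rightarrow> 't \<Rightarrow> bool" where
  "strict geq s t = (geq s t \<and> \<not> geq t s)"

definition quasi_order_on :: "'t set \<Rightarrow> ('t \<Rightarrow> 't \<Rightarrow> bool) \<Rightarrow> bool" where
  "quasi_order_on K geq = (reflp_on K geq \<and> transp_on K geq)"

definition well_founded_on :: "'t set \<Rightarrow> ('t \<Rightarrow> 't \<Rightarrow> bool) \<Rightarrow> bool" where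
  "well_founded_on K geq = (\<nexists>u :: nat \<Rightarrow> 't. \<forall>i. u i \<in> K \<and> strict geq (u i) (u (Suc i)))"

definition weakly_monotonic_on ::
  "('x, 'a, 'c, 'f) trm set \<Rightarrow> (('x, 'a, 'c, 'f) trm \<Rightarrow> ('x, 'a, 'c, 'f) trm \<Rightarrow> bool) \<Rightarrow> bool" where
  "weakly_monotonic_on K geq = (\<forall>s\<in>K. \<forall>t\<in>K. geq s t \<longrightarrow>
     (\<forall>c us vs. Con c (us @ s # vs) \<in> K \<longrightarrow> geq (Con c (us @ s # vs)) (Con c (us @ t # vs))) \<and>
     (\<forall>f us vs. Fun f (us @ s # vs) \<in> K \<longrightarrow> geq (Fun f (us @ s # vs)) (Fun f (us @ t # vs))))"

definition subst_closed_on ::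
  "('a, 'c, 'f) signature \<Rightarrow> ('x, 'a, 'c, 'f) trm set
   \<Rightarrow> (('x, 'a, 'c, 'f) trm \<Rightarrow> ('x, 'a, 'c, 'f) trm \<Rightarrow> bool) \<Rightarrow> bool" where
  "subst_closed_on \<Sigma> K R = (\<forall>s\<in>K. \<forall>t\<in>K. \<forall>\<sigma>. is_subst \<Sigma> \<sigma> \<and> (\<forall>x. classical (\<sigma> x)) \<and> R s t
     \<longrightarrow> R (subst \<sigma> s) (subst \<sigma> t))"

section \<open>Well-posedness of the reduction relation\<close>

text \<open>
  Terms denote formal linear combinations of classical terms, given a valuation of
  the variables inside amplitudes. Equivalence is sound for this interpretation.
\<close>

fun nat_den :: "('x \<Rightarrow> nat) \<Rightarrow> ('x, 'a, 'c, 'f) trm \<Rightarrow> nat" where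
  "nat_den \<nu> (Var x) = \<nu> x"
| "nat_den \<nu> (Con SuccC [t]) = Suc (nat_den \<nu> t)"
| "nat_den \<nu> _ = 0"

fun amp_den :: "('a, 'c, 'f) signature \<Rightarrow> ('x \<Rightarrow> nat) \<Rightarrow> ('x, 'a, 'c, 'f) amp \<Rightarrow> complex" where
  "amp_den \<Sigma> \<nu> (Amp b ts) = amp_int \<Sigma> b (map (nat_den \<nu>) ts)"
| "amp_den \<Sigma> \<nu> (AMul \<alpha> \<beta>) = amp_den \<Sigma> \<nu> \<alpha> * amp_den \<Sigma> \<nu> \<beta>"
| "amp_den \<Sigma> \<nu> (AAdd \<alpha> \<beta>) = amp_den \<Sigma> \<nu> \<alpha> + amp_den \<Sigma> \<nu> \<beta>"

fun list_den :: "('t \<Rightarrow> complex) list \<Rightarrow> 't list \<Rightarrow> complex" where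
  "list_den [] [] = 1"
| "list_den (d # ds) (u # us) = d u * list_den ds us"
| "list_den _ _ = 0"

fun den :: "('a, 'c, 'f) signature \<Rightarrow> ('x \<Rightarrow> nat) \<Rightarrow> ('x, 'a, 'c, 'f) trm
    \<Rightarrow> ('x, 'a, 'c, 'f) trm \<Rightarrow> complex" where
  "den \<Sigma> \<nu> (Var x) = (\<lambda>u. of_bool (u = Var x))"
| "den \<Sigma> \<nu> (Con c ts) =
     (\<lambda>u. case u of Con c' us \<Rightarrow> if c' = c then list_den (map (den \<Sigma> \<nu>) ts) us else 0 | _ \<Rightarrow> 0)"
| "den \<Sigma> \<nu> (Fun f ts) =
     (\<lambda>u. case u of Fun f' us \<Rightarrow> if f' = f then list_den (map (den \<Sigma> \<nu>) ts) us else 0 | _ \<Rightarrow> 0)"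
| "den \<Sigma> \<nu> (Scale \<alpha> t) = (\<lambda>u. amp_den \<Sigma> \<nu> \<alpha> * den \<Sigma> \<nu> t u)"
| "den \<Sigma> \<nu> (Add s t) = (\<lambda>u. den \<Sigma> \<nu> s u + den \<Sigma> \<nu> t u)"

primrec numeral_trm :: "nat \<Rightarrow> ('x, 'a, 'c, 'f) trm" where
  "numeral_trm 0 = Con ZeroC []"
| "numeral_trm (Suc n) = Con SuccC [numeral_trm n]"

lemma numeral_trm_props:
  "numeral_trm n \<in> vals \<Sigma>" "is_natural (numeral_trm n)" "tvars (numeral_trm n) = {}"
  "nat_val (numeral_trm n) = n"
  by (induction n) (auto simp: vals_def)

lemma natural_subst_numeral:
  assumes "is_natural t"
  shows "is_natural (subst (\<lambda>x. numeral_trm (\<nu> x)) t)"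
    and "tvars (subst (\<lambda>x. numeral_trm (\<nu> x)) t) = {}"
    and "nat_val (subst (\<lambda>x. numeral_trm (\<nu> x)) t) = nat_den \<nu> t"
  using assms by (induction t rule: is_natural.induct) (auto simp: numeral_trm_props)

lemma naturals_subst_numeral:
  "\<forall>t\<in>set ts. is_natural t \<Longrightarrow>
    map (nat_val \<circ> subst (\<lambda>x. numeral_trm (\<nu> x))) ts = map (nat_den \<nu>) ts"
  by (auto simp: natural_subst_numeral)

lemma amp_subst_numeral:
  assumes "wf_amp \<Sigma> \<alpha>"
  shows "wf_amp \<Sigma> (asubst (\<lambda>x. numeral_trm (\<nu> x)) \<alpha>)"
    and "avars (asubst (\<lambda>x. numeral_trm (\<nu> x)) \<alpha>) = {}"
    and "amp_eval \<Sigma> (asubst (\<lambda>x. numeral_trm (\<nu> x)) \<alpha>) = amp_den \<Sigma> \<nu> \<alpha>"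
  using assms
  by (induction \<alpha> rule: amp_den.induct)
     (auto simp: natural_subst_numeral naturals_subst_numeral)

lemma amp_is_den:
  assumes "amp_is \<Sigma> \<alpha> z" and "wf_amp \<Sigma> \<alpha>"
  shows "amp_den \<Sigma> \<nu> \<alpha> = z"
proof -
  have "is_subst \<Sigma> (\<lambda>x. numeral_trm (\<nu> x))"
    by (auto simp: is_subst_def numeral_trm_props)
  then show ?thesis
    using assms(1) amp_subst_numeral[OF assms(2), of \<nu>] unfolding amp_is_def by metis
qed

lemma subst_ground:
  fixes t :: "('x, 'a, 'c, 'f) trm" and \<alpha> :: "('x, 'a, 'c, 'f) amp"
  shows "tvars t = {} \<Longrightarrow> subst \<sigma> t = t" "avars \<alpha> = {} \<Longrightarrow> asubst \<sigma> \<alpha> = \<alpha>"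
  by (induction t and \<alpha>) (auto intro!: map_idI)

lemma amp_den_nonzero:
  assumes "\<not> amp_is \<Sigma> \<alpha> 0" and "wf_amp \<Sigma> \<alpha>" and "avars \<alpha> = {}"
  shows "amp_den \<Sigma> \<nu> \<alpha> \<noteq> 0"
proof -
  have "amp_eval \<Sigma> \<alpha> \<noteq> 0"
    using assms(1) subst_ground(2)[OF assms(3)] by (auto simp: amp_is_def)
  then show ?thesis
    using amp_subst_numeral(3)[OF assms(2), of \<nu>] subst_ground(2)[OF assms(3)] by simp
qed

lemma list_den_scale:
  "list_den (ds @ (\<lambda>u. z * d u) # es) us = z * list_den (ds @ d # es) us"
proof (induction ds arbitrary: us)
  case Nil
  show ?case by (cases us) auto
next
  case (Cons a ds)
  then show ?case by (cases us) auto
qed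

lemma list_den_add:
  "list_den (ds @ (\<lambda>u. d u + e u) # es) us
     = list_den (ds @ d # es) us + list_den (ds @ e # es) us"
proof (induction ds arbitrary: us)
  case Nil
  show ?case by (cases us) (auto simp: algebra_simps)
next
  case (Cons a ds)
  then show ?case by (cases us) (auto simp: algebra_simps)
qed

lemma den_eq_axiom:
  assumes "eq_axiom \<Sigma> s t" and "wf_trm \<Sigma> s" and "wf_trm \<Sigma> t"
  shows "den \<Sigma> \<nu> s = den \<Sigma> \<nu> t"
  using assms
proof (induction rule: eq_axiom.induct)
  case (zero \<alpha> s t)
  then show ?case using amp_is_den[of \<Sigma> \<alpha> 0 \<nu>] by simp
next
  case (one \<alpha> t)
  then show ?case using amp_is_den[of \<Sigma> \<alpha> 1 \<nu>] by simp
qed (auto simp: algebra_simps list_den_scale list_den_add fun_eq_iff split: trm.splits)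

lemma den_fill:
  "den \<Sigma> \<nu> s = den \<Sigma> \<nu> t \<Longrightarrow> den \<Sigma> \<nu> (fill C s) = den \<Sigma> \<nu> (fill C t)"
  by (induction C) (auto intro!: ext split: trm.splits)

lemma den_equiv: "equiv_trm \<Sigma> s t \<Longrightarrow> den \<Sigma> \<nu> s = den \<Sigma> \<nu> t"
  by (induction rule: equiv_trm.induct) (auto intro: den_eq_axiom den_fill)

lemma den_classical:
  "classical s \<Longrightarrow> den \<Sigma> \<nu> s = (\<lambda>u. of_bool (u = s))"
proof (induction s)
  case (Con c ts)
  have "list_den (map (den \<Sigma> \<nu>) ts) us = of_bool (us = ts)" for us
    using Con
  proof (induction ts arbitrary: us)
    case Nil
    show ?case by (cases us) auto
  next
    case (Cons a ts)
    then show ?case by (cases us) auto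
  qed
  then show ?case by (auto simp: fun_eq_iff split: trm.splits)
next
  case (Fun f ts)
  have "list_den (map (den \<Sigma> \<nu>) ts) us = of_bool (us = ts)" for us
    using Fun
  proof (induction ts arbitrary: us)
    case Nil
    show ?case by (cases us) auto
  next
    case (Cons a ts)
    then show ?case by (cases us) auto
  qed
  then show ?case by (auto simp: fun_eq_iff split: trm.splits)
qed auto

lemma classical_equiv_eq:
  assumes "equiv_trm \<Sigma> s t" and "classical s" and "classical t"
  shows "s = t"
proof -
  have "den \<Sigma> (\<lambda>_. 0) s s = den \<Sigma> (\<lambda>_. 0) t s"
    using den_equiv[OF assms(1)] by metis
  then show ?thesis
    using assms(2,3) by (auto simp: den_classical split: if_splits)
qed

lemma den_superpos:
  assumes "length \<alpha>s = length ts" and "ts \<noteq> []" and "\<forall>t\<in>set ts. classical t"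
  shows "den \<Sigma> \<nu> (superpos \<alpha>s ts) u = (\<Sum>i<length ts. amp_den \<Sigma> \<nu> (\<alpha>s ! i) * of_bool (u = ts ! i))"
  using assms
proof (induction \<alpha>s ts rule: superpos.induct)
  case ("2_1" \<alpha> \<beta> \<alpha>s t ts)
  then have "ts \<noteq> []" by auto
  then show ?case
    using "2_1" by (simp add: den_classical sum.lessThan_Suc_shift del: sum.lessThan_Suc)
next
  case ("2_2" \<alpha> \<alpha>s t u ts)
  then show ?case
    by (simp add: den_classical sum.lessThan_Suc_shift del: sum.lessThan_Suc)
qed (auto simp: den_classical)

lemma tvars_superpos:
  assumes "length \<alpha>s = length ts" and "ts \<noteq> []"
  shows "tvars (superpos \<alpha>s ts) = (\<Union>\<alpha>\<in>set \<alpha>s. avars \<alpha>) \<union> (\<Union>t\<in>set ts. tvars t)"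
  using assms
proof (induction \<alpha>s ts rule: superpos.induct)
  case ("2_1" \<alpha> \<beta> \<alpha>s t ts)
  then have "ts \<noteq> []" by auto
  then show ?case using "2_1" by auto
qed auto

lemma canonical_ground_coeff:
  assumes "canonical \<Sigma> \<alpha>s ts" and "superpos \<alpha>s ts \<in> ground_trms \<Sigma>" and "i < length ts"
  shows "den \<Sigma> \<nu> (superpos \<alpha>s ts) (ts ! i) \<noteq> 0"
proof -
  have len: "length \<alpha>s = length ts" and ne: "ts \<noteq> []" and dist: "distinct ts"
    and cl: "\<forall>t\<in>set ts. classical t"
    and amp: "wf_amp \<Sigma> (\<alpha>s ! i)" "\<not> amp_is \<Sigma> (\<alpha>s ! i) 0"
    using assms(1,3) by (auto simp: canonical_def)
  have "avars (\<alpha>s ! i) = {}"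
    using assms(2,3) len tvars_superpos[OF len ne] by (auto simp: ground_trms_def)
  then have nz: "amp_den \<Sigma> \<nu> (\<alpha>s ! i) \<noteq> 0"
    using amp by (intro amp_den_nonzero)
  have "den \<Sigma> \<nu> (superpos \<alpha>s ts) (ts ! i)
      = (\<Sum>k<length ts. amp_den \<Sigma> \<nu> (\<alpha>s ! k) * of_bool (ts ! i = ts ! k))"
    by (rule den_superpos[OF len ne cl])
  also have "\<dots> = (\<Sum>k<length ts. if k = i then amp_den \<Sigma> \<nu> (\<alpha>s ! k) else 0)"
    using dist assms(3) by (intro sum.cong) (auto simp: nth_eq_iff_index_eq)
  also have "\<dots> = amp_den \<Sigma> \<nu> (\<alpha>s ! i)"
    using assms(3) by simp
  finally show ?thesis using nz by simp
qed

lemma step_rel_classical: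
  assumes "step_rel S N s t" and "equiv_trm (sig S) s u" and "classical u"
  shows "\<exists>t. classical_step S u t"
  using assms
proof (induction arbitrary: u rule: step_rel.induct)
  case (C s t)
  have "classical s" using C.hyps by (auto elim: classical_step.cases)
  then show ?case using C classical_equiv_eq by blast
next
  case (E s s' t' t)
  then show ?case by (meson equiv_trm.sym equiv_trm.trans)
next
  case (Q \<alpha>s ss ts j)
  have "den (sig S) (\<lambda>_. 0) u (ss ! j) \<noteq> 0"
    using canonical_ground_coeff[OF Q.hyps(1,3,5)] den_equiv[OF Q.prems(1)] by metis
  then have "ss ! j = u"
    using Q.prems(2) by (auto simp: den_classical)
  moreover have "wf_trm (sig S) (ss ! j)"
    using Q.hyps(1,5) by (auto simp: canonical_def)
  ultimately show ?case
    using Q.IH(2) Q.prems(2) equiv_trm.refl by metis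
qed

lemma step_rel_cong:
  assumes "step_rel S N s t"
    and "\<And>s. s \<in> ground_trms (sig S) \<Longrightarrow> classical s \<Longrightarrow> s \<in> N \<Longrightarrow> s \<in> N'"
  shows "step_rel S N' s t"
  using assms(1)
proof (induction rule: step_rel.induct)
  case (Q \<alpha>s ss ts j)
  show ?case
  proof (rule step_rel.Q[OF Q.hyps(1-4) _ Q.hyps(5) Q.IH(2)])
    fix i assume i: "i < length ss"
    have len: "length \<alpha>s = length ss" and ne: "ss \<noteq> []" using Q.hyps(1) by (auto simp: canonical_def)
    have "ss ! i \<in> ground_trms (sig S)" "classical (ss ! i)"
      using i Q.hyps(1,3) tvars_superpos[OF len ne]
      by (auto simp: ground_trms_def canonical_def)
    then show "(ss ! i \<in> N' \<and> ts ! i = ss ! i) \<or> step_rel S N' (ss ! i) (ts ! i)"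
      using Q.IH(1)[OF i] assms(2) by blast
  qed
next
  case (C s t)
  then show ?case by (rule step_rel.C)
next
  case (E s s' t' t)
  show ?case by (rule step_rel.E[OF E.hyps(1) E.IH E.hyps(3-5)])
qed

lemma step_rel_eqI:
  assumes "\<And>s. s \<in> ground_trms (sig S) \<Longrightarrow> classical s \<Longrightarrow> s \<in> N \<longleftrightarrow> s \<in> N'"
  shows "step_rel S N = step_rel S N'"
proof (intro ext iffI)
  fix s t
  show "step_rel S N s t \<Longrightarrow> step_rel S N' s t"
    by (erule step_rel_cong) (use assms in blast)
  show "step_rel S N' s t \<Longrightarrow> step_rel S N s t"
    by (erule step_rel_cong) (use assms in blast)
qed

lemma normal_forms_step_rel:
  assumes "s \<in> ground_trms (sig S)" and "classical s"
  shows "s \<in> normal_forms S (step_rel S N)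
    \<longleftrightarrow> s \<in> {s \<in> ground_trms (sig S). \<nexists>t. classical_step S s t}"
proof -
  have "equiv_trm (sig S) s s"
    using assms(1) by (auto simp: ground_trms_def intro: equiv_trm.refl)
  then have "(\<exists>t. step_rel S N s t) \<longleftrightarrow> (\<exists>t. classical_step S s t)"
    using assms(2) step_rel_classical step_rel.C by metis
  then show ?thesis using assms(1) unfolding normal_forms_def by blast
qed

theorem step_unfold: "step S = step_rel S (normal_forms S (step S))"
  using normal_forms_step_rel unfolding step_def by (intro step_rel_eqI) blast

theorem step_unique:
  assumes "R = step_rel S (normal_forms S R)"
  shows "R = step S"
proof -
  have "s \<in> normal_forms S R \<longleftrightarrow> s \<in> {s \<in> ground_trms (sig S). \<nexists>t. classical_step S s t}"
    if "s \<in> ground_trms (sig S)" "classical s" for s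
    using normal_forms_step_rel[OF that, of "normal_forms S R"] assms by simp
  then have "step_rel S (normal_forms S R) = step S"
    unfolding step_def by (intro step_rel_eqI) blast
  then show ?thesis using assms by simp
qed

end

theory Submission
  imports Defs
begin

text \<open>
  Every ground term denotes a finitely supported linear combination of classical terms. A step acts
  on the whole support at once: each element of the support stays put if it is normal, and
  otherwise is replaced by the support of its classical reduct. Merging and cancellation of summands
  can only shrink the support, so a chain of \<open>n + 1\<close> steps yields a chain of \<open>n\<close> classical
  reducts (\<open>reduct\<close>) that starts in the support of the initial term. A classical reduct replaces an
  instance of a left-hand side \<open>l\<close> by the same instance of some summand of the canonical form of the
  right-hand side, so well-foundedness of \<open>reduct\<close> is the dependency pair criterion for an ordinary
  call-by-value rewrite system. The arguments of a redex are values there, so minimal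
  non-terminating terms are not needed: well-founded induction along the marked redexes suffices.
  Evaluation contexts and orthogonality make classical steps deterministic; hence \<open>reduct\<close> is finitely
  branching, and well-foundedness gives a uniform bound on the length of chains.
\<close>

section \<open>Substitution and contexts\<close>

lemma subst_cong:
  fixes t :: "('x, 'a, 'c, 'f) trm" and \<alpha> :: "('x, 'a, 'c, 'f) amp"
  shows "\<forall>x\<in>tvars t. \<sigma> x = \<tau> x \<Longrightarrow> subst \<sigma> t = subst \<tau> t"
    and "\<forall>x\<in>avars \<alpha>. \<sigma> x = \<tau> x \<Longrightarrow> asubst \<sigma> \<alpha> = asubst \<tau> \<alpha>"
  by (induction t and \<alpha>) auto

lemma subst_eqD:
  fixes t :: "('x, 'a, 'c, 'f) trm" and \<alpha> :: "('x, 'a, 'c, 'f) amp"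
  shows "subst \<sigma> t = subst \<tau> t \<Longrightarrow> \<forall>x\<in>tvars t. \<sigma> x = \<tau> x"
    and "asubst \<sigma> \<alpha> = asubst \<tau> \<alpha> \<Longrightarrow> \<forall>x\<in>avars \<alpha>. \<sigma> x = \<tau> x"
  by (induction t and \<alpha>) auto

lemma classical_substD: "classical (subst \<sigma> t) \<Longrightarrow> x \<in> tvars t \<Longrightarrow> classical (\<sigma> x)"
  by (induction t rule: classical.induct) auto

lemma classical_subst: "classical t \<Longrightarrow> \<forall>x. classical (\<sigma> x) \<Longrightarrow> classical (subst \<sigma> t)"
  by (induction t rule: classical.induct) auto

text \<open>A classical term has no amplitudes, the only place where replacing a variable by a value
  can break well-formedness.\<close>

lemma wf_subst: "classical t \<Longrightarrow> wf_trm \<Sigma> t \<Longrightarrow> is_subst \<Sigma> \<sigma> \<Longrightarrow> wf_trm \<Sigma> (subst \<sigma> t)"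
  by (induction t rule: classical.induct) (auto simp: is_subst_def vals_def)

lemma pattern_classical: "pattern p \<Longrightarrow> classical p"
  by (induction p rule: pattern.induct) auto

lemma value_shape_subst: "pattern p \<Longrightarrow> is_subst \<Sigma> \<sigma> \<Longrightarrow> value_shape (subst \<sigma> p)"
  by (induction p rule: pattern.induct) (auto simp: is_subst_def vals_def)

text \<open>Serves to see a subterm of a subterm of a right-hand side as a subterm of that
  right-hand side.\<close>

lemma fill_compose: "\<exists>C'. \<forall>t. fill C' t = fill C (fill D t)"
  by (induction C) (metis fill.simps)+

lemma classical_fillD: "eval_ctxt \<Sigma> E \<Longrightarrow> classical (fill E t) \<Longrightarrow> classical t"
  by (induction E) auto

lemma classical_fill:
  "eval_ctxt \<Sigma> E \<Longrightarrow> classical (fill E s) \<Longrightarrow> classical t \<Longrightarrow> classical (fill E t)"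
  by (induction E) auto

lemma wf_fill:
  "eval_ctxt \<Sigma> E \<Longrightarrow> wf_trm \<Sigma> (fill E s) \<Longrightarrow> wf_trm \<Sigma> t \<Longrightarrow> wf_trm \<Sigma> (fill E t)"
  by (induction E) auto

lemma fill_Fun_not_value: "\<not> value_shape (fill E (Fun f ts))" if "eval_ctxt \<Sigma> E"
  using that by (induction E) auto

text \<open>Both decompositions cut the list at its first element violating
  \<open>Q\<close>.\<close>

lemma split_at_first_unique:
  assumes "us @ a # vs = us' @ a' # vs'"
    and "\<forall>u\<in>set us. Q u" "\<not> Q a" "\<forall>u\<in>set us'. Q u" "\<not> Q a'"
  shows "us = us' \<and> a = a' \<and> vs = vs'"
  using assms by (induction us arbitrary: us') (auto simp: Cons_eq_append_conv split: list.splits)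

text \<open>A term that contains a function call at the hole is never a value. Going down from the
  root, the hole must therefore lie in the leftmost argument that is not a value, and the descent
  stops exactly at a call all of whose arguments are values.\<close>

lemma eval_ctxt_unique:
  assumes "fill E (Fun f ts) = fill E' (Fun f' ts')"
    and "eval_ctxt \<Sigma> E" and "eval_ctxt \<Sigma> E'"
    and "\<forall>t\<in>set ts. value_shape t" and "\<forall>t\<in>set ts'. value_shape t"
  shows "E = E' \<and> f = f' \<and> ts = ts'"
  using assms
proof (induction E arbitrary: E')
  case Hole
  then show ?case
    by (cases E') (auto dest: fill_Fun_not_value)
next
  case (ConCtxt c us E vs)
  then obtain us' E'' vs' where E': "E' = ConCtxt c us' E'' vs'"
    by (cases E') auto
  have "\<not> value_shape (fill E (Fun f ts))" "\<not> value_shape (fill E'' (Fun f' ts'))"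
    using ConCtxt.prems E' by (auto dest: fill_Fun_not_value)
  then have "us = us' \<and> fill E (Fun f ts) = fill E'' (Fun f' ts') \<and> vs = vs'"
    using ConCtxt.prems E'
    by (intro split_at_first_unique[where Q = value_shape]) (auto simp: vals_def)
  then show ?case using ConCtxt E' by auto
next
  case (FunCtxt c us E vs)
  show ?case
  proof (cases E')
    case Hole
    then show ?thesis using FunCtxt.prems by (auto dest: fill_Fun_not_value)
  next
    case (FunCtxt d us' E'' vs')
    note E' = this
    have "\<not> value_shape (fill E (Fun f ts))" "\<not> value_shape (fill E'' (Fun f' ts'))"
      using FunCtxt.prems E' by (auto dest: fill_Fun_not_value)
    then have "us = us' \<and> fill E (Fun f ts) = fill E'' (Fun f' ts') \<and> vs = vs'"
      using FunCtxt.prems E'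
      by (intro split_at_first_unique[where Q = value_shape]) (auto simp: vals_def)
    then show ?thesis using FunCtxt.IH[of E''] FunCtxt.prems E' by auto
  qed (use FunCtxt.prems in auto)
qed auto

section \<open>Determinism of classical steps\<close>

lemma classical_step_deterministic:
  assumes strs: "is_strs S" and "classical_step S s t" and "classical_step S s t'"
  shows "t = t'"
proof -
  from assms(2) obtain l r \<sigma> E where 1: "(l, r) \<in> rules S" "is_subst (sig S) \<sigma>"
    "eval_ctxt (sig S) E" "s = fill E (subst \<sigma> l)" "t = fill E (subst \<sigma> r)"
    by (auto elim!: classical_step.cases)
  from assms(3) obtain l' r' \<sigma>' E' where 2: "(l', r') \<in> rules S" "is_subst (sig S) \<sigma>'"
    "eval_ctxt (sig S) E'" "s = fill E' (subst \<sigma>' l')" "t' = fill E' (subst \<sigma>' r')"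
    by (auto elim!: classical_step.cases)
  have "rewrite_rule (sig S) l r" "rewrite_rule (sig S) l' r'"
    using strs 1(1) 2(1) by (auto simp: is_strs_def)
  then obtain f ps f' ps' where l: "l = Fun f ps" "\<forall>p\<in>set ps. pattern p"
    and l': "l' = Fun f' ps'" "\<forall>p\<in>set ps'. pattern p" and vars: "tvars r \<subseteq> tvars l"
    by (auto simp: rewrite_rule_def)
  have eq: "E = E' \<and> f = f' \<and> map (subst \<sigma>) ps = map (subst \<sigma>') ps'"
    using 1 2 l l' by (intro eval_ctxt_unique[of _ _ _ _ _ _ "sig S"]) (auto intro: value_shape_subst)
  then have sub: "subst \<sigma> l = subst \<sigma>' l'" using l l' by simp
  \<comment> \<open>Both left-hand sides match the same redex, so two different rules would overlap
    at the root.\<close>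
  have "overlap (l, r) (l', r')" if "(l, r) \<noteq> (l', r')"
    unfolding overlap_def using that sub l
    by (intro exI[of _ Hole] exI[of _ l] exI[of _ \<sigma>] exI[of _ \<sigma>']) auto
  then have same: "l = l'" "r = r'"
    using strs 1(1) 2(1) unfolding is_strs_def orthogonal_def by blast+
  \<comment> \<open>Equal instances of \<open>l\<close> force the two matchers to agree on the
    variables of \<open>l\<close>, which include those of \<open>r\<close>.\<close>
  then have "subst \<sigma> r = subst \<sigma>' r"
    using subst_eqD(1)[of \<sigma> l \<sigma>'] sub vars by (intro subst_cong(1)) blast
  then show ?thesis using 1 2 eq same by simp
qed

section \<open>Supports of denotations\<close>

lemma nat_den_subst: "is_natural t \<Longrightarrow> nat_den \<nu> (subst \<sigma> t) = nat_den (\<lambda>x. nat_den \<nu> (\<sigma> x)) t"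
  by (induction t rule: is_natural.induct) auto

text \<open>Instantiating an amplitude amounts to changing the valuation, so an identity valid for
  all valuations survives instantiation.\<close>

lemma amp_den_asubst:
  "wf_amp \<Sigma> \<alpha> \<Longrightarrow> amp_den \<Sigma> \<nu> (asubst \<sigma> \<alpha>) = amp_den \<Sigma> (\<lambda>x. nat_den \<nu> (\<sigma> x)) \<alpha>"
proof (induction \<Sigma> \<alpha> rule: wf_amp.induct)
  case (1 \<Sigma> b ts)
  then show ?case by (simp add: nat_den_subst cong: map_cong)
qed auto

text \<open>
  Substituting may make amplitudes ill-formed, so \<open>equiv_trm\<close> itself is not closed under
  substitution; its interpretation is, because \<open>nat_den\<close> is total.
\<close>

lemma den_subst_eq_axiom:
  assumes "eq_axiom \<Sigma> s t" and "wf_trm \<Sigma> s" and "wf_trm \<Sigma> t"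
  shows "den \<Sigma> \<nu> (subst \<sigma> s) = den \<Sigma> \<nu> (subst \<sigma> t)"
  using assms
proof (induction rule: eq_axiom.induct)
  case (zero \<alpha> s t)
  then show ?case using amp_is_den[of \<Sigma> \<alpha> 0] by (simp add: amp_den_asubst)
next
  case (one \<alpha> t)
  then show ?case using amp_is_den[of \<Sigma> \<alpha> 1] by (simp add: amp_den_asubst)
qed (auto simp: algebra_simps list_den_scale list_den_add fun_eq_iff split: trm.splits)

lemma den_subst_fill:
  "den \<Sigma> \<nu> (subst \<sigma> s) = den \<Sigma> \<nu> (subst \<sigma> t) \<Longrightarrow>
    den \<Sigma> \<nu> (subst \<sigma> (fill C s)) = den \<Sigma> \<nu> (subst \<sigma> (fill C t))"
  by (induction C) (auto intro!: ext split: trm.splits)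

lemma den_subst_equiv:
  "equiv_trm \<Sigma> s t \<Longrightarrow> den \<Sigma> \<nu> (subst \<sigma> s) = den \<Sigma> \<nu> (subst \<sigma> t)"
  by (induction rule: equiv_trm.induct) (auto intro: den_subst_eq_axiom den_subst_fill)

lemma equiv_trm_wf: "equiv_trm \<Sigma> s t \<Longrightarrow> wf_trm \<Sigma> s \<and> wf_trm \<Sigma> t"
  by (induction rule: equiv_trm.induct) auto

lemma subst_superpos:
  "length \<alpha>s = length ts \<Longrightarrow> ts \<noteq> [] \<Longrightarrow>
    subst \<sigma> (superpos \<alpha>s ts) = superpos (map (asubst \<sigma>) \<alpha>s) (map (subst \<sigma>) ts)"
  by (induction \<alpha>s ts rule: superpos.induct) (auto simp: neq_Nil_conv length_Suc_conv Suc_length_conv)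

text \<open>Summands may cancel but cannot create new support. The summands may themselves be
  superposed, as the targets of rule \<open>Q\<close> are.\<close>

lemma den_superpos_support:
  assumes "length \<alpha>s = length ts" and "ts \<noteq> []" and "den \<Sigma> \<nu> (superpos \<alpha>s ts) w \<noteq> 0"
  shows "\<exists>t\<in>set ts. den \<Sigma> \<nu> t w \<noteq> 0"
  using assms
proof (induction \<alpha>s ts rule: superpos.induct)
  case ("2_1" \<alpha> \<beta> \<alpha>s t ts)
  then have "ts \<noteq> []" by auto
  then show ?case using "2_1" by (cases "den \<Sigma> \<nu> t w = 0") auto
next
  case ("2_2" \<alpha> \<alpha>s t u ts)
  then show ?case by auto
qed auto

section \<open>Supports of argument lists and of filled contexts\<close>

lemma list_den_support: "list_den ds us \<noteq> 0 \<Longrightarrow> list_all2 (\<lambda>d u. d u \<noteq> 0) ds us"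
  by (induction ds us rule: list_den.induct) auto

text \<open>A classical argument denotes an indicator function, so a nonzero product fixes every
  entry except the one at \<open>t\<close>.\<close>

lemma list_den_classical_support:
  assumes "list_den (map (den \<Sigma> \<nu>) (us @ t # vs)) ws \<noteq> 0"
    and "\<forall>u\<in>set us \<union> set vs. classical u"
  shows "\<exists>w. ws = us @ w # vs \<and> den \<Sigma> \<nu> t w \<noteq> 0"
  using assms
proof (induction us arbitrary: ws)
  case Nil
  have id: "list_den (map (den \<Sigma> \<nu>) vs) xs \<noteq> 0 \<Longrightarrow> \<forall>u\<in>set vs. classical u \<Longrightarrow> xs = vs" for xs
  proof (induction vs arbitrary: xs)
    case Nil
    then show ?case by (cases xs) auto
  next
    case (Cons a vs)
    then show ?case by (cases xs) (auto simp: den_classical split: if_splits)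
  qed
  show ?case using Nil id by (cases ws) auto
next
  case (Cons a us)
  then show ?case by (cases ws) (auto simp: den_classical split: if_splits)
qed

text \<open>Evaluation contexts distribute over sums in the hole. The term \<open>s\<close> is there
  only to say that the surroundings of the hole are classical; \<open>t\<close> may be
  superposed.\<close>

lemma den_fill_support:
  assumes "eval_ctxt \<Sigma> E" and "classical (fill E s)" and "den \<Sigma> \<nu> (fill E t) w \<noteq> 0"
  shows "\<exists>w'. w = fill E w' \<and> den \<Sigma> \<nu> t w' \<noteq> 0"
  using assms
proof (induction E arbitrary: w)
  case (ConCtxt c us E vs)
  then obtain ws where w: "w = Con c ws"
    and "list_den (map (den \<Sigma> \<nu>) (us @ fill E t # vs)) ws \<noteq> 0"
    by (auto split: trm.splits if_splits)
  then obtain w' where "ws = us @ w' # vs" "den \<Sigma> \<nu> (fill E t) w' \<noteq> 0"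
    using list_den_classical_support[of \<Sigma> \<nu> us "fill E t" vs ws] ConCtxt.prems by auto
  then show ?case using ConCtxt w by auto
next
  case (FunCtxt f us E vs)
  then obtain ws where w: "w = Fun f ws"
    and "list_den (map (den \<Sigma> \<nu>) (us @ fill E t # vs)) ws \<noteq> 0"
    by (auto split: trm.splits if_splits)
  then obtain w' where "ws = us @ w' # vs" "den \<Sigma> \<nu> (fill E t) w' \<noteq> 0"
    using list_den_classical_support[of \<Sigma> \<nu> us "fill E t" vs ws] FunCtxt.prems by auto
  then show ?case using FunCtxt w by auto
qed auto

section \<open>Finiteness of supports\<close>

lemma finite_list_den_support:
  assumes "\<forall>d\<in>set ds. finite {u. d u \<noteq> 0}"
  shows "finite {us. list_den ds us \<noteq> 0}"
  using assms
proof (induction ds)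
  case Nil
  have "{us. list_den [] us \<noteq> 0} \<subseteq> {[]}"
    by (auto dest: list_den_support)
  then show ?case by (rule finite_subset) simp
next
  case (Cons d ds)
  have "{us. list_den (d # ds) us \<noteq> 0} \<subseteq> (\<lambda>(u, us). u # us) ` ({u. d u \<noteq> 0} \<times> {us. list_den ds us \<noteq> 0})"
  proof
    fix us assume "us \<in> {us. list_den (d # ds) us \<noteq> 0}"
    then show "us \<in> (\<lambda>(u, us). u # us) ` ({u. d u \<noteq> 0} \<times> {us. list_den ds us \<noteq> 0})"
      by (cases us) auto
  qed
  then show ?case using Cons by (auto intro: finite_subset)
qed

lemma finite_den_support: "finite {u. den \<Sigma> \<nu> t u \<noteq> 0}"
\<comment> \<open>This rule recurses through terms only and avoids a mutual induction over
  amplitudes.\<close>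
proof (induction \<Sigma> t rule: wf_trm.induct)
  case (2 \<Sigma> c ts)
  have "{u. den \<Sigma> \<nu> (Con c ts) u \<noteq> 0} \<subseteq> Con c ` {us. list_den (map (den \<Sigma> \<nu>) ts) us \<noteq> 0}"
  proof
    fix u assume "u \<in> {u. den \<Sigma> \<nu> (Con c ts) u \<noteq> 0}"
    then show "u \<in> Con c ` {us. list_den (map (den \<Sigma> \<nu>) ts) us \<noteq> 0}"
      by (cases u) (auto split: if_splits)
  qed
  moreover have "finite {us. list_den (map (den \<Sigma> \<nu>) ts) us \<noteq> 0}"
    using 2 by (intro finite_list_den_support) auto
  ultimately show ?case by (blast intro: finite_subset)
next
  case (3 \<Sigma> f ts)
  have "{u. den \<Sigma> \<nu> (Fun f ts) u \<noteq> 0} \<subseteq> Fun f ` {us. list_den (map (den \<Sigma> \<nu>) ts) us \<noteq> 0}"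
  proof
    fix u assume "u \<in> {u. den \<Sigma> \<nu> (Fun f ts) u \<noteq> 0}"
    then show "u \<in> Fun f ` {us. list_den (map (den \<Sigma> \<nu>) ts) us \<noteq> 0}"
      by (cases u) (auto split: if_splits)
  qed
  moreover have "finite {us. list_den (map (den \<Sigma> \<nu>) ts) us \<noteq> 0}"
    using 3 by (intro finite_list_den_support) auto
  ultimately show ?case by (blast intro: finite_subset)
next
  case (4 \<Sigma> \<alpha> t)
  then show ?case by (auto intro: finite_subset[rotated])
next
  case (5 \<Sigma> s t)
  have "{u. den \<Sigma> \<nu> (Add s t) u \<noteq> 0} \<subseteq> {u. den \<Sigma> \<nu> s u \<noteq> 0} \<union> {u. den \<Sigma> \<nu> t u \<noteq> 0}"
    by auto
  then show ?case using 5 by (blast intro: finite_subset)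
qed auto

section \<open>Dependency pairs for call-by-value rewriting of classical terms\<close>

text \<open>\<open>P\<close> pairs a left-hand side with a single classical summand, so this is
  ordinary rewriting. The substitution is classical on all variables, to match the closure of the
  quasi-order under substitution.\<close>

inductive cbv_step ::
  "('a, 'c, 'f) signature \<Rightarrow> (('x, 'a, 'c, 'f) trm \<times> ('x, 'a, 'c, 'f) trm) set
   \<Rightarrow> ('x, 'a, 'c, 'f) trm \<Rightarrow> ('x, 'a, 'c, 'f) trm \<Rightarrow> bool" for \<Sigma> P where
  "(l, p) \<in> P \<Longrightarrow> is_subst \<Sigma> \<sigma> \<Longrightarrow> \<forall>x. classical (\<sigma> x) \<Longrightarrow> eval_ctxt \<Sigma> E
   \<Longrightarrow> wf_trm \<Sigma> (fill E (subst \<sigma> l)) \<Longrightarrow> classical (fill E (subst \<sigma> l))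
   \<Longrightarrow> cbv_step \<Sigma> P (fill E (subst \<sigma> l)) (fill E (subst \<sigma> p))"

abbreviation mark :: "'f \<Rightarrow> ('x, 'a, 'c, 'f) trm list \<Rightarrow> ('x, 'a, 'c, 'f tupled) trm" where
  "mark f ts \<equiv> Fun (Tup f) (map base ts)"

lemma con_ar_tupled_sig [simp]: "con_ar (tupled_sig \<Sigma>) c = con_ar \<Sigma> c"
  by (cases c) (auto simp: tupled_sig_def)

lemma fun_ar_tupled_sig [simp]:
  "fun_ar (tupled_sig \<Sigma>) (Base f) = fun_ar \<Sigma> f" "fun_ar (tupled_sig \<Sigma>) (Tup f) = fun_ar \<Sigma> f"
  by (auto simp: tupled_sig_def)

lemma base_tupled_trms: "classical t \<Longrightarrow> wf_trm \<Sigma> t \<Longrightarrow> base t \<in> tupled_trms \<Sigma>"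
  by (induction t rule: classical.induct) (auto simp: tupled_trms_def con.map_id)

lemma mark_tupled_trms:
  "classical (Fun f ts) \<Longrightarrow> wf_trm \<Sigma> (Fun f ts) \<Longrightarrow> mark f ts \<in> tupled_trms \<Sigma>"
  using base_tupled_trms[of _ \<Sigma>] by (auto simp: tupled_trms_def)

lemma value_shape_base: "classical v \<Longrightarrow> value_shape v \<Longrightarrow> value_shape (base v)"
  by (induction v rule: classical.induct) auto

lemma base_subst: "classical t \<Longrightarrow> base (subst \<sigma> t) = subst (base \<circ> \<sigma>) (base t)"
  by (induction t rule: classical.induct) auto

lemma is_subst_base:
  "is_subst \<Sigma> \<sigma> \<Longrightarrow> \<forall>x. classical (\<sigma> x) \<Longrightarrow> is_subst (tupled_sig \<Sigma>) (base \<circ> \<sigma>)"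
  using base_tupled_trms[of _ \<Sigma>]
  by (auto simp: is_subst_def vals_def tupled_trms_def intro: value_shape_base)

lemma strict_geq_trans:
  "quasi_order_on K geq \<Longrightarrow> strict geq s t \<Longrightarrow> geq t u \<Longrightarrow> s \<in> K \<Longrightarrow> t \<in> K \<Longrightarrow> u \<in> K
    \<Longrightarrow> strict geq s u"
  unfolding quasi_order_on_def strict_def by (blast dest: transp_onD)

locale dependency_pair_order =
  fixes \<Sigma> :: "('a, 'c, 'f) signature"
    and P :: "(('x, 'a, 'c, 'f) trm \<times> ('x, 'a, 'c, 'f) trm) set"
    and geq :: "('x, 'a, 'c, 'f tupled) trm \<Rightarrow> ('x, 'a, 'c, 'f tupled) trm \<Rightarrow> bool"
  assumes quasi_order: "quasi_order_on (tupled_trms \<Sigma>) geq"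
    and well_founded: "well_founded_on (tupled_trms \<Sigma>) geq"
    and weakly_monotonic: "weakly_monotonic_on (tupled_trms \<Sigma>) geq"
    and subst_geq: "subst_closed_on (tupled_sig \<Sigma>) (tupled_trms \<Sigma>) geq"
    and subst_strict: "subst_closed_on (tupled_sig \<Sigma>) (tupled_trms \<Sigma>) (strict geq)"
    and lhs: "\<And>l p. (l, p) \<in> P \<Longrightarrow> wf_trm \<Sigma> l \<and> (\<exists>f ps. l = Fun f ps \<and> (\<forall>p\<in>set ps. pattern p))"
    and rhs: "\<And>l p. (l, p) \<in> P \<Longrightarrow> wf_trm \<Sigma> p \<and> classical p"
    and rule_geq: "\<And>l p. (l, p) \<in> P \<Longrightarrow> geq (base l) (base p)"
    and pair_strict: "\<And>f ss C g ts. (Fun f ss, fill C (Fun g ts)) \<in> P \<Longrightarrow>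
      strict geq (mark f ss) (mark g ts)"
begin

text \<open>The pairs are reversed because \<open>acc\<close> descends towards first components;
  membership in \<open>SN\<close> is then strong normalization.\<close>

abbreviation steps :: "(('x, 'a, 'c, 'f) trm \<times> ('x, 'a, 'c, 'f) trm) set" where
  "steps \<equiv> {(t, s). cbv_step \<Sigma> P s t}"

abbreviation SN :: "('x, 'a, 'c, 'f) trm set" where
  "SN \<equiv> Wellfounded.acc steps"

section \<open>Compatibility of steps with the quasi-order\<close>

lemma cbv_step_wf_classical:
  assumes "cbv_step \<Sigma> P s t"
  shows "wf_trm \<Sigma> s" "classical s" "wf_trm \<Sigma> t" "classical t"
  using assms
  by (auto elim!: cbv_step.cases intro: wf_fill classical_fill wf_subst classical_subst dest: rhs)

lemma geq_refl: "t \<in> tupled_trms \<Sigma> \<Longrightarrow> geq t t"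
  using quasi_order by (auto simp: quasi_order_on_def dest: reflp_onD)

lemma geq_trans:
  "geq s t \<Longrightarrow> geq t u \<Longrightarrow> s \<in> tupled_trms \<Sigma> \<Longrightarrow> t \<in> tupled_trms \<Sigma> \<Longrightarrow> u \<in> tupled_trms \<Sigma> \<Longrightarrow> geq s u"
  using quasi_order unfolding quasi_order_on_def by (blast dest: transp_onD)

lemma geq_Con:
  assumes "geq (base s) (base t)" and "classical (Con c (us @ s # vs))" "wf_trm \<Sigma> (Con c (us @ s # vs))"
    and "classical t" "wf_trm \<Sigma> t"
  shows "geq (base (Con c (us @ s # vs))) (base (Con c (us @ t # vs)))"
  using weakly_monotonic base_tupled_trms[OF assms(2,3)] assms base_tupled_trms[of s] base_tupled_trms[of t]
  unfolding weakly_monotonic_on_def by auto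

lemma geq_Fun:
  assumes "geq (base s) (base t)" and "classical (Fun f (us @ s # vs))" "wf_trm \<Sigma> (Fun f (us @ s # vs))"
    and "classical t" "wf_trm \<Sigma> t"
  shows "geq (base (Fun f (us @ s # vs))) (base (Fun f (us @ t # vs)))"
    and "geq (mark f (us @ s # vs)) (mark f (us @ t # vs))"
  using weakly_monotonic base_tupled_trms[OF assms(2,3)] mark_tupled_trms[OF assms(2,3)] assms
    base_tupled_trms[of s] base_tupled_trms[of t]
  unfolding weakly_monotonic_on_def by auto

lemma geq_fill:
  assumes "eval_ctxt \<Sigma> E" and "geq (base s) (base t)"
    and "classical (fill E s)" "wf_trm \<Sigma> (fill E s)" "classical t" "wf_trm \<Sigma> t"
  shows "geq (base (fill E s)) (base (fill E t))"
  using assms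
proof (induction E)
  case (ConCtxt c us E vs)
  then have "geq (base (fill E s)) (base (fill E t))" by (intro ConCtxt.IH) auto
  then have "geq (base (Con c (us @ fill E s # vs))) (base (Con c (us @ fill E t # vs)))"
    using ConCtxt.prems by (intro geq_Con) (auto intro: classical_fill wf_fill)
  then show ?case by (simp only: fill.simps)
next
  case (FunCtxt f us E vs)
  then have "geq (base (fill E s)) (base (fill E t))" by (intro FunCtxt.IH) auto
  then have "geq (base (Fun f (us @ fill E s # vs))) (base (Fun f (us @ fill E t # vs)))"
    using FunCtxt.prems by (intro geq_Fun(1)) (auto intro: classical_fill wf_fill)
  then show ?case by (simp only: fill.simps)
qed auto

lemma lhs_classical: "(l, p) \<in> P \<Longrightarrow> classical l"
  using lhs pattern_classical by fastforce

text \<open>The weak decrease of a rule is carried to the redex by closure under substitution, and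
  through the context by weak monotonicity.\<close>

lemma cbv_step_geq:
  assumes "cbv_step \<Sigma> P s t"
  shows "geq (base s) (base t)"
  using assms
proof cases
  case (1 l p \<sigma> E)
  have "geq (subst (base \<circ> \<sigma>) (base l)) (subst (base \<circ> \<sigma>) (base p))"
  proof -
    have "base l \<in> tupled_trms \<Sigma>" "base p \<in> tupled_trms \<Sigma>"
      using 1 lhs[of l p] rhs[of l p] lhs_classical[of l p] base_tupled_trms by blast+
    moreover have "classical ((base \<circ> \<sigma>) x)" for x
      using 1(5) base_tupled_trms[of "\<sigma> x" \<Sigma>] 1(4)
      by (auto simp: is_subst_def vals_def tupled_trms_def)
    ultimately show ?thesis
      using subst_geq rule_geq[OF 1(3)] is_subst_base[OF 1(4,5)]
      unfolding subst_closed_on_def by blast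
  qed
  then have "geq (base (subst \<sigma> l)) (base (subst \<sigma> p))"
    using lhs_classical[OF 1(3)] rhs[OF 1(3)] by (simp add: base_subst)
  then show ?thesis
    using 1 rhs[OF 1(3)] by (auto intro!: geq_fill intro: classical_subst wf_subst)
qed

section \<open>Strong normalization\<close>

lemma values_SN:
  assumes "value_shape v"
  shows "v \<in> SN"
proof (rule accI, clarsimp)
  fix t assume "cbv_step \<Sigma> P v t"
  then show "t \<in> SN"
    by cases (use assms lhs in \<open>fastforce simp: fill_Fun_not_value\<close>)
qed

text \<open>No redex has a constructor at its root, so every step rewrites one argument, and these
  steps are well-founded on the list of arguments.\<close>

lemma Con_SN:
  assumes "set ts \<subseteq> SN"
  shows "Con c ts \<in> SN"
proof -
  have "ts \<in> Wellfounded.acc (listrel1 steps)"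
    using assms by (intro lists_accD) auto
  then show ?thesis
  proof (induction rule: acc_induct_rule)
    case (1 ts)
    show ?case
    proof (rule accI, clarsimp)
      fix t assume step: "cbv_step \<Sigma> P (Con c ts) t"
      then show "t \<in> SN"
      proof cases
        case step: (1 l p \<sigma> E)
        obtain f ps where "l = Fun f ps" using lhs step by blast
        then obtain us E' vs where E: "E = ConCtxt c us E' vs"
          using step by (cases E) auto
        then have "cbv_step \<Sigma> P (fill E' (subst \<sigma> l)) (fill E' (subst \<sigma> p))"
          using step by (auto intro!: cbv_step.intros)
        then have "(us @ fill E' (subst \<sigma> p) # vs, ts) \<in> listrel1 steps"
          using step E by (auto simp: listrel1_def)
        then show ?thesis using "1.IH" step E by auto
      qed
    qed
  qed
qed

text \<open>Steps inside the arguments lower the marked term only weakly, and the root can be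
  contracted only when all arguments are values. The last hypothesis covers every list of values
  weakly below \<open>ts\<close>, so that by transitivity it persists when an argument is
  rewritten.\<close>

lemma Fun_SN:
  assumes "set ts \<subseteq> SN" and "wf_trm \<Sigma> (Fun g ts)" and "classical (Fun g ts)"
    and "\<And>ws. \<forall>w\<in>set ws. value_shape w \<Longrightarrow> wf_trm \<Sigma> (Fun g ws) \<Longrightarrow> classical (Fun g ws) \<Longrightarrow>
      geq (mark g ts) (mark g ws) \<Longrightarrow> Fun g ws \<in> SN"
  shows "Fun g ts \<in> SN"
proof -
  have "ts \<in> Wellfounded.acc (listrel1 steps)"
    using assms(1) by (intro lists_accD) auto
  then show ?thesis
    using assms(2-)
  proof (induction rule: acc_induct_rule)
    case (1 ts)
    show ?case
    proof (rule accI, clarsimp)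
      fix t assume "cbv_step \<Sigma> P (Fun g ts) t"
      then show "t \<in> SN"
      proof cases
        case step: (1 l p \<sigma> E)
        obtain f ps where l: "l = Fun f ps" "\<forall>p\<in>set ps. pattern p" using lhs step by blast
        show ?thesis
        proof (cases E)
          case Hole
          then have "\<forall>w\<in>set ts. value_shape w"
            using step l by (auto intro: value_shape_subst)
          \<comment> \<open>The arguments are already values, so the last hypothesis applies to
            \<open>ts\<close> itself by reflexivity.\<close>
          then have "Fun g ts \<in> SN"
            by (rule 1(5)[OF _ 1(3,4) geq_refl[OF mark_tupled_trms[OF 1(4,3)]]])
          then show ?thesis
            using \<open>cbv_step \<Sigma> P (Fun g ts) t\<close> by (auto dest: acc_downward)
        next
          case (FunCtxt f us E' vs)
          let ?ts' = "us @ fill E' (subst \<sigma> p) # vs"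
          have ts: "ts = us @ fill E' (subst \<sigma> l) # vs" "t = Fun g ?ts'"
            using step FunCtxt by auto
          have inner: "cbv_step \<Sigma> P (fill E' (subst \<sigma> l)) (fill E' (subst \<sigma> p))"
            using step FunCtxt by (auto intro!: cbv_step.intros)
          then have lr: "(?ts', ts) \<in> listrel1 steps"
            using ts by (auto simp: listrel1_def)
          have wf: "wf_trm \<Sigma> (Fun g ?ts')" "classical (Fun g ?ts')"
            using 1(3,4) ts cbv_step_wf_classical[OF inner] by auto
          have ge: "geq (mark g ts) (mark g ?ts')"
            using geq_Fun(2)[OF cbv_step_geq[OF inner] _ _ cbv_step_wf_classical(4,3)[OF inner]]
              1(3,4) unfolding ts(1) by blast
          have "Fun g ?ts' \<in> SN"
          proof (rule 1(2)[OF lr wf])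
            fix ws assume ws: "\<forall>w\<in>set ws. value_shape w" "wf_trm \<Sigma> (Fun g ws)" "classical (Fun g ws)"
              and "geq (mark g ?ts') (mark g ws)"
            then have "geq (mark g ts) (mark g ws)"
              using geq_trans[OF ge] mark_tupled_trms[OF 1(4,3)] mark_tupled_trms[OF wf(2,1)]
                mark_tupled_trms[OF ws(3,2)] by blast
            then show "Fun g ws \<in> SN" by (rule 1(5)[OF ws])
          qed
          then show ?thesis using ts by simp
        qed (use step in auto)
      qed
    qed
  qed
qed

lemma wf_strict: "wf {(t, s). s \<in> tupled_trms \<Sigma> \<and> t \<in> tupled_trms \<Sigma> \<and> strict geq s t}"
  using well_founded unfolding wf_iff_no_infinite_down_chain well_founded_on_def by blast

lemma pair_strict_subst:
  assumes "(Fun f ss, fill C (Fun g ts)) \<in> P" and "is_subst \<Sigma> \<sigma>" and "\<forall>x. classical (\<sigma> x)"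
    and "classical (Fun g ts)" and "wf_trm \<Sigma> (Fun g ts)"
  shows "strict geq (mark f (map (subst \<sigma>) ss)) (mark g (map (subst \<sigma>) ts))"
proof -
  have "classical ((base \<circ> \<sigma>) x)" for x
    using assms(2,3) base_tupled_trms[of "\<sigma> x" \<Sigma>]
    by (auto simp: is_subst_def vals_def tupled_trms_def)
  moreover have cl: "classical (Fun f ss)" using lhs_classical[OF assms(1)] .
  moreover have "mark f ss \<in> tupled_trms \<Sigma>" "mark g ts \<in> tupled_trms \<Sigma>"
    using lhs[OF assms(1)] cl assms(4,5) by (auto intro!: mark_tupled_trms)
  ultimately have "strict geq (subst (base \<circ> \<sigma>) (mark f ss)) (subst (base \<circ> \<sigma>) (mark g ts))"
    using subst_strict pair_strict[OF assms(1)] is_subst_base[OF assms(2,3)]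
    unfolding subst_closed_on_def by blast
  moreover have "subst (base \<circ> \<sigma>) (mark f ss) = mark f (map (subst \<sigma>) ss)"
    "subst (base \<circ> \<sigma>) (mark g ts) = mark g (map (subst \<sigma>) ts)"
    using cl assms(4) by (auto simp: base_subst)
  ultimately show ?thesis by (simp only:)
qed

text \<open>By well-founded induction on the marked call. Each call in the contracted right-hand
  side has a strictly smaller mark by its dependency pair; evaluating its arguments keeps it
  strictly smaller, so the induction hypothesis applies once they are values.\<close>

lemma Fun_values_SN:
  assumes "\<forall>v\<in>set vs. value_shape v" and "wf_trm \<Sigma> (Fun f vs)" and "classical (Fun f vs)"
  shows "Fun f vs \<in> SN"
  using wf_strict assms
proof (induction "mark f vs" arbitrary: f vs rule: wf_induct_rule)
  case less
  show ?case
  proof (rule accI, clarsimp)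
    fix t assume "cbv_step \<Sigma> P (Fun f vs) t"
    then show "t \<in> SN"
    proof cases
      case step: (1 l p \<sigma> E)
      obtain f' ps where l: "l = Fun f' ps" using lhs step by blast
      \<comment> \<open>A deeper hole would put a function call inside one of the arguments, which
        are values.\<close>
      have "E = Hole"
        using step l less.prems(1) by (cases E) (auto dest: fill_Fun_not_value)
      then have t: "t = subst \<sigma> p" "f' = f" "vs = map (subst \<sigma>) ps"
        using step l by auto
      \<comment> \<open>Generalized from \<open>p\<close> to its subterms \<open>u\<close>; the
        context \<open>C\<close> records where \<open>u\<close> occurs, which identifies the
        dependency pair in the function case.\<close>
      have "subst \<sigma> u \<in> SN" if "fill C u = p" "classical u" "wf_trm \<Sigma> u" for C u
        using that
      proof (induction u arbitrary: C rule: classical.induct)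
        case (1 x)
        then show ?case using step(4) by (auto simp: is_subst_def vals_def intro: values_SN)
      next
        case (2 c ts)
        have "subst \<sigma> t \<in> SN" if t: "t \<in> set ts" for t
        proof -
          obtain us ws where "ts = us @ t # ws" using t by (meson split_list)
          then have "fill (ConCtxt c us Hole ws) t = Con c ts" by simp
          then obtain C' where "fill C' t = p" using fill_compose[of C] 2(2) by metis
          then show ?thesis using 2 t by auto
        qed
        then show ?case by (auto intro!: Con_SN)
      next
        case (3 g ts)
        have "subst \<sigma> t \<in> SN" if t: "t \<in> set ts" for t
        proof -
          obtain us ws where "ts = us @ t # ws" using t by (meson split_list)
          then have "fill (FunCtxt g us Hole ws) t = Fun g ts" by simp
          then obtain C' where "fill C' t = p" using fill_compose[of C] 3(2) by metis
          then show ?thesis using 3 t by auto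
        qed
        then have args: "set (map (subst \<sigma>) ts) \<subseteq> SN" by auto
        have "(Fun f ps, fill C (Fun g ts)) \<in> P"
          using step(3) l t 3(2) by simp
        then have gt: "strict geq (mark f vs) (mark g (map (subst \<sigma>) ts))"
          using pair_strict_subst step(4,5) 3(3,4) t by simp
        have wf: "wf_trm \<Sigma> (Fun g (map (subst \<sigma>) ts))" "classical (Fun g (map (subst \<sigma>) ts))"
          using wf_subst[OF 3(3,4) step(4)] classical_subst[OF 3(3) step(5)] by auto
        have "Fun g (map (subst \<sigma>) ts) \<in> SN"
        proof (rule Fun_SN[OF args wf])
          fix ws assume ws: "\<forall>w\<in>set ws. value_shape w" "wf_trm \<Sigma> (Fun g ws)" "classical (Fun g ws)"
            and ge: "geq (mark g (map (subst \<sigma>) ts)) (mark g ws)"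
          note K = mark_tupled_trms[OF less.prems(3,2)] mark_tupled_trms[OF wf(2,1)]
            mark_tupled_trms[OF ws(3,2)]
          have "strict geq (mark f vs) (mark g ws)"
            by (rule strict_geq_trans[OF quasi_order gt ge K])
          then show "Fun g ws \<in> SN"
            using K by (intro less.hyps ws) simp
        qed
        then show ?case by simp
      qed auto
      then show ?thesis
        using rhs[OF step(3)] t(1) fill.simps(1) by metis
    qed
  qed
qed

text \<open>Terms that are ill-formed or not classical have no step at all; the others are built up
  from their arguments.\<close>

lemma all_SN: "t \<in> SN"
proof (cases "wf_trm \<Sigma> t \<and> classical t")
  case True
  then show ?thesis
  proof (induction t rule: classical.induct)
    case (1 x)
    show ?case
    proof (rule accI, clarsimp)
      fix t assume "cbv_step \<Sigma> P (Var x) t"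
      then show "t \<in> SN"
      proof cases
        case (1 l p \<sigma> E)
        then show ?thesis using lhs[of l p] by (cases E) auto
      qed
    qed
  next
    case (2 c ts)
    then show ?case by (intro Con_SN) auto
  next
    case (3 f ts)
    then have "set ts \<subseteq> SN" "wf_trm \<Sigma> (Fun f ts)" "classical (Fun f ts)" by auto
    then show ?case by (rule Fun_SN) (rule Fun_values_SN)
  qed auto
next
  case False
  then have "(y, t) \<notin> steps" for y
    using cbv_step_wf_classical(1,2) by auto
  then show ?thesis by (blast intro: accI)
qed

end

section \<open>From superposed to classical reduction\<close>

text \<open>A form of Koenig's lemma: accessibility together with finite branching gives a uniform
  bound.\<close>

lemma acc_finitely_branching_bounded:
  assumes "x \<in> Wellfounded.acc {(y, x). R x y}" and fin: "\<And>x. finite {y. R x y}"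
  shows "\<exists>k. \<forall>n y. (R ^^ n) x y \<longrightarrow> n \<le> k"
  using assms(1)
proof (induction rule: acc_induct_rule)
  case (1 x)
  then have "\<forall>y\<in>{y. R x y}. \<exists>k. \<forall>n z. (R ^^ n) y z \<longrightarrow> n \<le> k" by auto
  then obtain h where h: "\<forall>y\<in>{y. R x y}. \<forall>n z. (R ^^ n) y z \<longrightarrow> n \<le> h y"
    by (rule bchoice[THEN exE])
  \<comment> \<open>The sum dominates the bound of each successor and needs no special case for a
    term without successors.\<close>
  have "n \<le> Suc (\<Sum>y\<in>{y. R x y}. h y)" if "(R ^^ n) x z" for n z
  proof (cases n)
    case (Suc m)
    with that have "(R ^^ Suc m) x z" by simp
    then obtain y where y: "R x y" "(R ^^ m) y z" by (elim relpowp_Suc_E2)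
    then have "m \<le> h y" using h by auto
    also have "h y \<le> (\<Sum>y\<in>{y. R x y}. h y)" using y fin by (intro member_le_sum) auto
    finally show ?thesis using Suc by simp
  qed simp
  then show ?case by blast
qed

text \<open>Only terms surviving cancellation count as reducts. The result of a classical step is
  ground, so the choice of the zero valuation is immaterial.\<close>

definition reduct :: "('x, 'a, 'c, 'f) strs \<Rightarrow> ('x, 'a, 'c, 'f) trm \<Rightarrow> ('x, 'a, 'c, 'f) trm \<Rightarrow> bool" where
  "reduct S u w = (\<exists>t. classical_step S u t \<and> den (sig S) (\<lambda>_. 0) t w \<noteq> 0)"

text \<open>By determinism, all reducts of \<open>u\<close> lie in the support of one term.\<close>

lemma finite_reducts:
  assumes "is_strs S"
  shows "finite {w. reduct S u w}"
proof (cases "\<exists>t. classical_step S u t")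
  case True
  then obtain t where "classical_step S u t" by blast
  then have "{w. reduct S u w} \<subseteq> {w. den (sig S) (\<lambda>_. 0) t w \<noteq> 0}"
    using classical_step_deterministic[OF assms] by (auto simp: reduct_def)
  then show ?thesis by (rule finite_subset) (rule finite_den_support)
qed (auto simp: reduct_def)

text \<open>Instantiation preserves the equality of denotations between \<open>r\<close> and its
  canonical form, so whatever survives in the hole is an instance of a single summand.\<close>

lemma reduct_cbv_step:
  assumes strs: "is_strs S" and "reduct S u w"
    and P: "\<And>l r. (l, r) \<in> rules S \<Longrightarrow>
      (\<exists>\<alpha>s rs. canonical_form (sig S) \<alpha>s rs r \<and> (\<forall>p\<in>set rs. (l, p) \<in> P)) \<or> null_trm (sig S) r"
  shows "cbv_step (sig S) P u w"
proof -
  let ?den = "den (sig S) (\<lambda>_. 0)"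
  from assms(2) obtain l r \<sigma> E where step: "(l, r) \<in> rules S" "is_subst (sig S) \<sigma>"
    "eval_ctxt (sig S) E" "classical u" "u \<in> ground_trms (sig S)" "u = fill E (subst \<sigma> l)"
    and w: "?den (fill E (subst \<sigma> r)) w \<noteq> 0"
    by (auto simp: reduct_def elim!: classical_step.cases)
  have vars: "tvars r \<subseteq> tvars l"
    using strs step(1) by (auto simp: is_strs_def rewrite_rule_def)
  text \<open>Only the values of \<open>\<sigma>\<close> on the variables of \<open>l\<close> are known to be classical.\<close>
  define \<tau> where "\<tau> x = (if x \<in> tvars l then \<sigma> x else Con UnitC [])" for x
  have \<tau>: "is_subst (sig S) \<tau>"
    using step(2) by (auto simp: \<tau>_def is_subst_def vals_def)
  have "classical (subst \<sigma> l)"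
    using step classical_fillD by blast
  then have cl: "classical (\<tau> x)" for x
    by (auto simp: \<tau>_def intro: classical_substD)
  have l: "subst \<tau> l = subst \<sigma> l"
    by (rule subst_cong) (simp add: \<tau>_def)
  have r: "subst \<tau> r = subst \<sigma> r"
    by (rule subst_cong) (use vars in \<open>auto simp: \<tau>_def\<close>)
  obtain w' where w': "w = fill E w'" "?den (subst \<tau> r) w' \<noteq> 0"
    using den_fill_support[OF step(3) _ w] step r by auto
  \<comment> \<open>A null right-hand side has empty support under every instance and thus no
    reduct.\<close>
  have "\<not> null_trm (sig S) r"
  proof
    assume "null_trm (sig S) r"
    then obtain \<alpha> t where "amp_is (sig S) \<alpha> 0" and eq: "equiv_trm (sig S) r (Scale \<alpha> t)"
      by (auto simp: null_trm_def)
    moreover have "wf_amp (sig S) \<alpha>" using equiv_trm_wf[OF eq] by simp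
    ultimately have "?den (subst \<tau> (Scale \<alpha> t)) w' = 0"
      using amp_is_den[of "sig S" \<alpha> 0] by (simp add: amp_den_asubst)
    then show False using den_subst_equiv[OF eq] w'(2) by metis
  qed
  then obtain \<alpha>s rs where can: "canonical (sig S) \<alpha>s rs" "equiv_trm (sig S) (superpos \<alpha>s rs) r"
    and rs: "\<forall>p\<in>set rs. (l, p) \<in> P"
    using P[OF step(1)] by (auto simp: canonical_form_def)
  have "length \<alpha>s = length rs" "rs \<noteq> []" using can by (auto simp: canonical_def)
  \<comment> \<open>Instantiation may identify summands or make coefficients vanish, so only the
    one-sided bound on the support is used.\<close>
  moreover from this have "?den (superpos (map (asubst \<tau>) \<alpha>s) (map (subst \<tau>) rs)) w' \<noteq> 0"
    using den_subst_equiv[OF can(2)] w'(2) subst_superpos by metis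
  ultimately obtain p where p: "p \<in> set rs" "?den (subst \<tau> p) w' \<noteq> 0"
    using den_superpos_support[of "map (asubst \<tau>) \<alpha>s" "map (subst \<tau>) rs" "sig S" "\<lambda>_. 0" w']
    by auto
  moreover have "classical p" using can p by (auto simp: canonical_def)
  ultimately have "w' = subst \<tau> p"
    using cl by (auto simp: den_classical classical_subst split: if_splits)
  then have "w = fill E (subst \<tau> p)" "u = fill E (subst \<tau> l)"
    using w' step l by auto
  then show ?thesis
    using rs p \<tau> cl step by (auto simp: ground_trms_def intro: cbv_step.intros)
qed

text \<open>Equivalence preserves supports, which settles \<open>E\<close>; in \<open>Q\<close>, the
  support of the target comes from the targets of the single summands. The second half records that
  a step really rewrites some term of the support.\<close>

lemma step_support:
  fixes S :: "('x, 'a, 'c, 'f) strs"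
  defines "supp \<equiv> \<lambda>t. {u. den (sig S) (\<lambda>_. 0) t u \<noteq> 0}"
    and "NF \<equiv> {s \<in> ground_trms (sig S). \<nexists>t. classical_step S s t}"
  assumes "step S s t"
  shows "(\<forall>w\<in>supp t. \<exists>u\<in>supp s. u \<in> NF \<and> w = u \<or> reduct S u w) \<and>
    (\<exists>u\<in>supp s. \<exists>t. classical_step S u t)"
  using assms(3) unfolding step_def NF_def[symmetric]
proof (induction rule: step_rel.induct)
  case (C s t)
  then have "classical s" by (auto elim: classical_step.cases)
  then have "supp s = {s}" by (auto simp: supp_def den_classical)
  then show ?case using C by (auto simp: supp_def reduct_def)
next
  case (E s s' t' t)
  have "supp s = supp s'" "supp t' = supp t"
    using den_equiv E.hyps unfolding supp_def by metis+
  then show ?case using E.IH by simp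
next
  case (Q \<alpha>s ss ts j)
  have len: "length \<alpha>s = length ss" "ss \<noteq> []" and cl: "\<forall>s\<in>set ss. classical s"
    using Q.hyps(1) by (auto simp: canonical_def)
  have single: "supp (ss ! i) = {ss ! i}" if "i < length ss" for i
    using cl that by (auto simp: supp_def den_classical)
  \<comment> \<open>Nothing cancels in the source: its summands are distinct and its ground
    coefficients are nonzero.\<close>
  have mem: "ss ! i \<in> supp (superpos \<alpha>s ss)" if "i < length ss" for i
    using canonical_ground_coeff[OF Q.hyps(1,3) that] by (simp add: supp_def)
  have "\<exists>u\<in>supp (superpos \<alpha>s ss). u \<in> NF \<and> w = u \<or> reduct S u w" if "w \<in> supp (superpos \<alpha>s ts)" for w
  proof -
    have "length \<alpha>s = length ts" "ts \<noteq> []" using len Q.hyps(2) by auto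
    then have "\<exists>t\<in>set ts. w \<in> supp t"
      using den_superpos_support[of \<alpha>s ts "sig S" "\<lambda>_. 0" w] that by (simp add: supp_def)
    then obtain i where i: "i < length ss" "w \<in> supp (ts ! i)"
      using Q.hyps(2) by (metis in_set_conv_nth)
    have "ss ! i \<in> NF \<and> w = ss ! i \<or> reduct S (ss ! i) w"
      using Q.IH(1)[OF i(1)]
    proof (elim disjE conjE)
      assume "ss ! i \<in> NF" "ts ! i = ss ! i"
      then show ?thesis using i(2) single[OF i(1)] by simp
    next
      assume "\<forall>w\<in>supp (ts ! i). \<exists>u\<in>supp (ss ! i). u \<in> NF \<and> w = u \<or> reduct S u w"
      then show ?thesis using i(2) unfolding single[OF i(1)] by blast
    qed
    then show ?thesis using mem[OF i(1)] by blast
  qed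
  moreover have "\<exists>u\<in>supp (superpos \<alpha>s ss). \<exists>t. classical_step S u t"
    using Q.IH(2) mem[OF Q.hyps(5)] unfolding single[OF Q.hyps(5)] by blast
  ultimately show ?case by blast
qed

text \<open>The chain is traced backwards from a reducible term of the final support; every
  predecessor found on the way is again reducible.\<close>

lemma steps_support:
  assumes "(step S ^^ n) s t" and "den (sig S) (\<lambda>_. 0) t w \<noteq> 0" and "classical_step S w w'"
  shows "\<exists>u. den (sig S) (\<lambda>_. 0) s u \<noteq> 0 \<and> (reduct S ^^ n) u w"
  using assms
proof (induction n arbitrary: t w w')
  case (Suc n)
  then obtain t' where t': "(step S ^^ n) s t'" "step S t' t" by auto
  \<comment> \<open>Since \<open>w\<close> is reducible it cannot have stayed put as a normal form,
    so it is a reduct.\<close>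
  obtain v where v: "den (sig S) (\<lambda>_. 0) t' v \<noteq> 0" "reduct S v w"
    using step_support[OF t'(2)] Suc.prems(2,3) by blast
  then obtain v' where "classical_step S v v'" by (auto simp: reduct_def)
  then obtain u where "den (sig S) (\<lambda>_. 0) s u \<noteq> 0" "(reduct S ^^ n) u v"
    using Suc.IH[OF t'(1) v(1)] by blast
  then show ?case using v(2) by (blast intro: relpowp_Suc_I)
qed auto

lemma terminating_if_reducts_accessible:
  fixes S :: "('x, 'a, 'c, 'f) strs"
  assumes strs: "is_strs S" and acc: "\<And>u. u \<in> Wellfounded.acc {(w, u). reduct S u w}"
  shows "terminating S"
  unfolding terminating_def terminates_def
proof
  fix t :: "('x, 'a, 'c, 'f) trm"
  let ?supp = "{u. den (sig S) (\<lambda>_. 0) t u \<noteq> 0}"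
  have "\<forall>u. \<exists>k. \<forall>n w. (reduct S ^^ n) u w \<longrightarrow> n \<le> k"
    using acc_finitely_branching_bounded[OF acc finite_reducts[OF strs]] by blast
  then obtain h where h: "\<forall>u n w. (reduct S ^^ n) u w \<longrightarrow> n \<le> h u"
    by (rule choice[THEN exE])
  have "n \<le> Suc (\<Sum>u\<in>?supp. h u)" if "(step S ^^ n) t s" for n s
  proof (cases n)
    case (Suc m)
    with that have "(step S ^^ Suc m) t s" by simp
    then obtain s' where s': "(step S ^^ m) t s'" "step S s' s" by (elim relpowp_Suc_E)
    \<comment> \<open>The last step serves only to supply a reducible term in the support of
      \<open>s'\<close>; this accounts for the \<open>Suc\<close> in the bound.\<close>
    obtain w w' where "den (sig S) (\<lambda>_. 0) s' w \<noteq> 0" "classical_step S w w'"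
      using step_support[OF s'(2)] by blast
    then obtain u where u: "u \<in> ?supp" "(reduct S ^^ m) u w"
      using steps_support[OF s'(1)] by blast
    have "m \<le> h u" using h u(2) by blast
    also have "\<dots> \<le> (\<Sum>u\<in>?supp. h u)"
      using u(1) finite_den_support by (intro member_le_sum) auto
    finally show ?thesis using Suc by simp
  qed simp
  then show "\<exists>k. \<forall>n u. (step S ^^ n) t u \<longrightarrow> n \<le> k" by blast
qed

theorem theorem37:
  fixes S :: "('x :: countable, 'a, 'c, 'f) strs"
    and geq :: "('x, 'a, 'c, 'f tupled) trm \<Rightarrow> ('x, 'a, 'c, 'f tupled) trm \<Rightarrow> bool"
  assumes strs: "is_strs S"
    and quasi_order: "quasi_order_on (tupled_trms (sig S)) geq"
    and well_founded: "well_founded_on (tupled_trms (sig S)) geq"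
    and weakly_monotonic: "weakly_monotonic_on (tupled_trms (sig S)) geq"
    and subst_geq: "subst_closed_on (tupled_sig (sig S)) (tupled_trms (sig S)) geq"
    and subst_strict: "subst_closed_on (tupled_sig (sig S)) (tupled_trms (sig S)) (strict geq)"
    and rules_geq: "\<And>l r. (l, r) \<in> rules S \<Longrightarrow>
      (\<exists>\<alpha>s rs. canonical_form (sig S) \<alpha>s rs r \<and> (\<forall>r\<^sub>i\<in>set rs. geq (base l) (base r\<^sub>i)))
      \<or> null_trm (sig S) r"
    and pairs_strict: "\<And>s t. (s, t) \<in> dependency_pairs S \<Longrightarrow> strict geq s t"
  shows "terminating S"
proof -
  \<comment> \<open>One classical rule per summand. \<open>in_can\<close> ranges over all canonical
    forms of \<open>r\<close>, whereas weak decrease is given for one of them, so the decrease is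
    built into \<open>P\<close>.\<close>
  define P where "P = {(l, p). \<exists>r. (l, r) \<in> rules S \<and> in_can (sig S) p r \<and> geq (base l) (base p)}"
  have rule: "rewrite_rule (sig S) l r" if "(l, r) \<in> rules S" for l r
    using strs that by (auto simp: is_strs_def)
  interpret dependency_pair_order "sig S" P geq
  proof
    show "wf_trm (sig S) l \<and> (\<exists>f ps. l = Fun f ps \<and> (\<forall>p\<in>set ps. pattern p))" if "(l, p) \<in> P" for l p
      using that rule by (auto simp: P_def rewrite_rule_def)
    show "wf_trm (sig S) p \<and> classical p" if "(l, p) \<in> P" for l p
      using that by (auto simp: P_def in_can_def canonical_form_def canonical_def)
    show "geq (base l) (base p)" if "(l, p) \<in> P" for l p
      using that unfolding P_def by blast
    show "strict geq (mark f ss) (mark g ts)" if pair: "(Fun f ss, fill C (Fun g ts)) \<in> P" for f ss C g ts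
    proof -
      obtain r where "(Fun f ss, r) \<in> rules S" "in_can (sig S) (fill C (Fun g ts)) r"
        using pair unfolding P_def by blast
      then have "(mark f ss, mark g ts) \<in> dependency_pairs S"
        by (rule dependency_pairs.intros)
      then show ?thesis by (rule pairs_strict)
    qed
  qed fact+
  have P: "(\<exists>\<alpha>s rs. canonical_form (sig S) \<alpha>s rs r \<and> (\<forall>p\<in>set rs. (l, p) \<in> P)) \<or> null_trm (sig S) r"
    if lr: "(l, r) \<in> rules S" for l r
    using rules_geq[OF lr]
  proof (elim disjE exE conjE)
    fix \<alpha>s rs assume can: "canonical_form (sig S) \<alpha>s rs r"
      and geq: "\<forall>p\<in>set rs. geq (base l) (base p)"
    have "(l, p) \<in> P" if "p \<in> set rs" for p
      using lr can geq that unfolding P_def in_can_def by blast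
    then show ?thesis using can by blast
  qed simp
  have "{(w, u). reduct S u w} \<subseteq> steps"
    using reduct_cbv_step[OF strs _ P] by auto
  then have "u \<in> Wellfounded.acc {(w, u). reduct S u w}" for u
    using acc_subset[of "{(w, u). reduct S u w}" steps] all_SN by blast
  then show ?thesis by (rule terminating_if_reducts_accessible[OF strs])
qed

end
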